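(* Let $G$ be a finite group of linear automorphisms of the finite dimensional vector space $V$ over a field $k$, let $M$ be a finite dimensional $kG$-module, let $W$ be the subgroup of $G$ generated by the elements of $G$ that fix some linear hyperplane of $V$ point-wise, and let $K$ be a subgroup such that $W\leq K\leq G$. Then $k[V]^G(M)$ is free over $k[V]^G$ if and only if $k[V]^K(M)$ is free over $k[V]^K$ and $k[V]^G(M)$ and $k[V]^K(M)$ share generators.
   Context: $k$ is a field of arbitrary characteristic; $k[V]$ is the coordinate ring of $V$ (polynomial algebra on a basis of $V^*$, standard grading) with the induced $G$-action. For a subgroup $H\leq G$, $k[V]^H$ is the invariant ring and $k[V]^H(M):=(k[V]\otimes_k M)^H$ (diagonal action) is the module of covariants of type $M$, a graded $k[V]^H$-module. "$k[V]^G(M)$ and $k[V]^K(M)$ share generators" means that $k[V]^K(M)$ can be generated as a $k[V]^K$-module by $G$-invariant elements, i.e. by elements of $k[V]^G(M)\subseteq k[V]^K(M)$. *)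

theory Defs
  imports
    Complex_Main
    "HOL-Algebra.Module"
    "HOL-Algebra.Generated_Groups"
    "HOL-Library.Poly_Mapping"
begin

section \<open>Linear groups\<close>

definition general_linear ::
    "('k::field \<Rightarrow> 'v::ab_group_add \<Rightarrow> 'v) \<Rightarrow> ('v \<Rightarrow> 'v) monoid" where
  "general_linear s =
     \<lparr>carrier = {g. Vector_Spaces.linear s s g \<and> bij g}, mult = (\<circ>), one = id\<rparr>"

definition fixes_hyperplane ::
    "('k::field \<Rightarrow> 'v::ab_group_add \<Rightarrow> 'v) \<Rightarrow> ('v \<Rightarrow> 'v) \<Rightarrow> bool" where
  "fixes_hyperplane s g \<longleftrightarrow>
     (\<exists>U. module.subspace s U \<and> vector_space.dim s U + 1 = vector_space.dim s UNIV \<and>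
          (\<forall>u\<in>U. g u = u))"


section \<open>The coordinate ring\<close>

text \<open>
  Polynomials are formal (over a finite field they differ from polynomial functions).  Given a
  basis \<open>B\<close> of \<open>V\<close>, the variable with index \<open>b \<in> B\<close> is the coordinate function
  \<open>x\<^sub>b \<in> V\<^sup>*\<close>, i.e. the element of the dual basis belonging to \<open>b\<close>.  Coefficients may be taken
  in an arbitrary abelian group, see below.
\<close>

type_synonym ('v, 'c) mpoly = "('v \<Rightarrow>\<^sub>0 nat) \<Rightarrow>\<^sub>0 'c"

definition mpolys :: "'v set \<Rightarrow> ('v, 'c::zero) mpoly set" where
  "mpolys B = {p. \<forall>\<alpha>\<in>Poly_Mapping.keys p. Poly_Mapping.keys \<alpha> \<subseteq> B}"

text \<open>
  The induced action is \<open>(g f)(v) = f (g\<^sup>-\<^sup>1 v)\<close>.  On coordinate functions this means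
  \<open>g x\<^sub>b = (\<Sum>c\<in>B. x\<^sub>b (g\<^sup>-\<^sup>1 c) x\<^sub>c)\<close>, and it is extended to an algebra homomorphism.
\<close>

definition coord_act ::
    "('k::field \<Rightarrow> 'v::ab_group_add \<Rightarrow> 'v) \<Rightarrow> 'v set \<Rightarrow> ('v \<Rightarrow> 'v) \<Rightarrow> 'v \<Rightarrow> ('v, 'k) mpoly" where
  "coord_act s B g b =
     (\<Sum>c\<in>B. Poly_Mapping.single (Poly_Mapping.single c 1)
                (module.representation s B (inv_into UNIV g c) b))"

definition poly_act ::
    "('k::field \<Rightarrow> 'v::ab_group_add \<Rightarrow> 'v) \<Rightarrow> 'v set \<Rightarrow> ('v \<Rightarrow> 'v) \<Rightarrow>
      ('v, 'k) mpoly \<Rightarrow> ('v, 'k) mpoly" where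
  "poly_act s B g f =
     (\<Sum>\<alpha>\<in>Poly_Mapping.keys f. Poly_Mapping.single 0 (Poly_Mapping.lookup f \<alpha>) *
                    (\<Prod>b\<in>Poly_Mapping.keys \<alpha>. coord_act s B g b ^ Poly_Mapping.lookup \<alpha> b))"

definition invariant_ring ::
    "('k::field \<Rightarrow> 'v::ab_group_add \<Rightarrow> 'v) \<Rightarrow> 'v set \<Rightarrow> ('v \<Rightarrow> 'v) set \<Rightarrow> ('v, 'k) mpoly ring" where
  "invariant_ring s B H =
     \<lparr>carrier = {f \<in> mpolys B. \<forall>h\<in>H. poly_act s B h f = f},
      mult = (*), one = 1, zero = 0, add = (+)\<rparr>"


section \<open>Covariants\<close>

text \<open>
  The tensor product of \<open>k[V]\<close> and \<open>M\<close> over \<open>k\<close> is realised as the set of polynomials with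
  coefficients in \<open>M\<close>: the pure tensor of \<open>f = (\<Sum>\<alpha>. a\<^sub>\<alpha> x\<^sup>\<alpha>)\<close> and \<open>m\<close> is the polynomial with
  coefficients \<open>a\<^sub>\<alpha> m\<close>.  The universal property is verified in lemma \<open>tensor_universal\<close> below.  The
  diagonal action and the multiplication by polynomials are obtained from
  \<open>g (f \<otimes> m) = g f \<otimes> g m\<close> and \<open>f (h \<otimes> m) = f h \<otimes> m\<close>, applied to the expansion
  \<open>t = (\<Sum>\<alpha>. x\<^sup>\<alpha> \<otimes> t\<^sub>\<alpha>)\<close>.
\<close>

definition tensor ::
    "('k::field \<Rightarrow> 'm::ab_group_add \<Rightarrow> 'm) \<Rightarrow> ('v, 'k) mpoly \<Rightarrow> 'm \<Rightarrow> ('v, 'm) mpoly" where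
  "tensor sM f m = Poly_Mapping.map (\<lambda>a. sM a m) f"

definition tensor_act ::
    "('k::field \<Rightarrow> 'v::ab_group_add \<Rightarrow> 'v) \<Rightarrow> 'v set \<Rightarrow> ('k \<Rightarrow> 'm::ab_group_add \<Rightarrow> 'm) \<Rightarrow>
      (('v \<Rightarrow> 'v) \<Rightarrow> 'm \<Rightarrow> 'm) \<Rightarrow> ('v \<Rightarrow> 'v) \<Rightarrow> ('v, 'm) mpoly \<Rightarrow> ('v, 'm) mpoly" where
  "tensor_act s B sM \<rho> g t =
     (\<Sum>\<alpha>\<in>Poly_Mapping.keys t.
        tensor sM (poly_act s B g (Poly_Mapping.single \<alpha> 1)) (\<rho> g (Poly_Mapping.lookup t \<alpha>)))"

definition poly_smult ::
    "('k::field \<Rightarrow> 'm::ab_group_add \<Rightarrow> 'm) \<Rightarrow> ('v, 'k) mpoly \<Rightarrow> ('v, 'm) mpoly \<Rightarrow> ('v, 'm) mpoly" where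
  "poly_smult sM f t =
     (\<Sum>\<alpha>\<in>Poly_Mapping.keys t. tensor sM (f * Poly_Mapping.single \<alpha> 1) (Poly_Mapping.lookup t \<alpha>))"

text \<open>The multiplicative part of the module record carries no meaning.\<close>

definition covariants ::
    "('k::field \<Rightarrow> 'v::ab_group_add \<Rightarrow> 'v) \<Rightarrow> 'v set \<Rightarrow> ('k \<Rightarrow> 'm::ab_group_add \<Rightarrow> 'm) \<Rightarrow>
      (('v \<Rightarrow> 'v) \<Rightarrow> 'm \<Rightarrow> 'm) \<Rightarrow> ('v \<Rightarrow> 'v) set \<Rightarrow> (('v, 'k) mpoly, ('v, 'm) mpoly) module" where
  "covariants s B sM \<rho> H =
     \<lparr>carrier = {t \<in> mpolys B. \<forall>h\<in>H. tensor_act s B sM \<rho> h t = t},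
      mult = undefined, one = undefined, zero = 0, add = (+), smult = poly_smult sM\<rparr>"


section \<open>Generators and freeness\<close>

definition generates_module ::
    "('r, 'a) ring_scheme \<Rightarrow> ('r, 'b, 'c) module_scheme \<Rightarrow> 'b set \<Rightarrow> bool" where
  "generates_module R M S \<longleftrightarrow>
     S \<subseteq> carrier M \<and>
     (\<forall>x\<in>carrier M. \<exists>A c. finite A \<and> A \<subseteq> S \<and> c \<in> A \<rightarrow> carrier R \<and>
        x = (\<Oplus>\<^bsub>M\<^esub>a\<in>A. c a \<odot>\<^bsub>M\<^esub> a))"

definition module_independent ::
    "('r, 'a) ring_scheme \<Rightarrow> ('r, 'b, 'c) module_scheme \<Rightarrow> 'b set \<Rightarrow> bool" where
  "module_independent R M S \<longleftrightarrow>
     (\<forall>A c. finite A \<and> A \<subseteq> S \<and> c \<in> A \<rightarrow> carrier R \<and>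
        (\<Oplus>\<^bsub>M\<^esub>a\<in>A. c a \<odot>\<^bsub>M\<^esub> a) = \<zero>\<^bsub>M\<^esub> \<longrightarrow> (\<forall>a\<in>A. c a = \<zero>\<^bsub>R\<^esub>))"

definition free_module ::
    "('r, 'a) ring_scheme \<Rightarrow> ('r, 'b, 'c) module_scheme \<Rightarrow> bool" where
  "free_module R M \<longleftrightarrow> (\<exists>S. generates_module R M S \<and> module_independent R M S)"

definition share_generators ::
    "('k::field \<Rightarrow> 'v::ab_group_add \<Rightarrow> 'v) \<Rightarrow> 'v set \<Rightarrow> ('k \<Rightarrow> 'm::ab_group_add \<Rightarrow> 'm) \<Rightarrow>
      (('v \<Rightarrow> 'v) \<Rightarrow> 'm \<Rightarrow> 'm) \<Rightarrow> ('v \<Rightarrow> 'v) set \<Rightarrow> ('v \<Rightarrow> 'v) set \<Rightarrow> bool" where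
  "share_generators s B sM \<rho> G K \<longleftrightarrow>
     (\<exists>S \<subseteq> carrier (covariants s B sM \<rho> G).
        generates_module (invariant_ring s B K) (covariants s B sM \<rho> K) S)"


section \<open>Consistency of the definitions\<close>

lemma sum_keys_superset:
  assumes "\<And>\<alpha>. \<phi> \<alpha> 0 = 0" "finite A" "Poly_Mapping.keys t \<subseteq> A"
  shows "(\<Sum>\<alpha>\<in>Poly_Mapping.keys t. \<phi> \<alpha> (Poly_Mapping.lookup t \<alpha>)) =
         (\<Sum>\<alpha>\<in>A. \<phi> \<alpha> (Poly_Mapping.lookup t \<alpha>))"
  using assms by (intro sum.mono_neutral_left) (auto simp: in_keys_iff)

lemma sum_keys_add:
  assumes "\<And>\<alpha>. \<phi> \<alpha> 0 = 0" "\<And>\<alpha> x y. \<phi> \<alpha> (x + y) = \<phi> \<alpha> x + \<phi> \<alpha> y"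
  shows "(\<Sum>\<alpha>\<in>Poly_Mapping.keys (t + u). \<phi> \<alpha> (Poly_Mapping.lookup (t + u) \<alpha>)) =
         (\<Sum>\<alpha>\<in>Poly_Mapping.keys t. \<phi> \<alpha> (Poly_Mapping.lookup t \<alpha>)) +
         (\<Sum>\<alpha>\<in>Poly_Mapping.keys u. \<phi> \<alpha> (Poly_Mapping.lookup u \<alpha>))"
  by (rule setsum_keys_plus_distrib) (use assms in auto)

lemma poly_mapping_sum_single:
  "t = (\<Sum>\<alpha>\<in>Poly_Mapping.keys t. Poly_Mapping.single \<alpha> (Poly_Mapping.lookup t \<alpha>))"
  by (rule poly_mapping_eqI) (auto simp: lookup_sum lookup_single when_def in_keys_iff)

lemma poly_mapping_add_induct [case_names single add]:
  fixes t :: "'a \<Rightarrow>\<^sub>0 'b::comm_monoid_add"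
  assumes s: "\<And>\<alpha> x. P (Poly_Mapping.single \<alpha> x)"
    and a: "\<And>u v. P u \<Longrightarrow> P v \<Longrightarrow> P (u + v)"
  shows "P t"
proof -
  have "P (\<Sum>\<alpha>\<in>A. Poly_Mapping.single \<alpha> (Poly_Mapping.lookup t \<alpha>))" if "finite A" for A
    using that
  proof induction
    case empty
    show ?case using s[of undefined 0] by simp
  qed (auto intro: s a)
  from this[OF finite_keys] show ?thesis
    by (subst poly_mapping_sum_single) auto
qed

lemma single_mpolys:
  "Poly_Mapping.single \<alpha> x \<in> mpolys B \<longleftrightarrow> x = 0 \<or> Poly_Mapping.keys \<alpha> \<subseteq> B"
  by (auto simp: mpolys_def)

lemma zero_mpolys [simp]: "0 \<in> mpolys B"
  and one_mpolys [simp]: "1 \<in> mpolys B"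
  by (auto simp: mpolys_def simp flip: single_one)

lemma add_mpolys: "p \<in> mpolys B \<Longrightarrow> q \<in> mpolys B \<Longrightarrow> p + q \<in> mpolys B"
  using keys_add[of p q] by (auto simp: mpolys_def)

lemma uminus_mpolys: "p \<in> mpolys B \<Longrightarrow> - p \<in> mpolys (B :: 'v set)"
  for p :: "('v, 'c::ab_group_add) mpoly"
  by (auto simp: mpolys_def in_keys_iff)

lemma sum_mpolys: "(\<And>i. i \<in> I \<Longrightarrow> p i \<in> mpolys B) \<Longrightarrow> sum p I \<in> mpolys B"
  by (induction I rule: infinite_finite_induct) (auto intro: add_mpolys)

lemma keys_monom_add: "Poly_Mapping.keys (\<alpha> + \<beta>) = Poly_Mapping.keys \<alpha> \<union> Poly_Mapping.keys \<beta>"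
  for \<alpha> \<beta> :: "'v \<Rightarrow>\<^sub>0 nat"
  by (auto simp: in_keys_iff lookup_add)

lemma mult_mpolys: "p \<in> mpolys B \<Longrightarrow> q \<in> mpolys B \<Longrightarrow> p * q \<in> mpolys (B :: 'v set)"
  for p q :: "('v, 'c::semiring_0) mpoly"
  using keys_mult[of p q] by (fastforce simp: mpolys_def keys_monom_add)

lemma prod_mpolys: "(\<And>i. i \<in> I \<Longrightarrow> p i \<in> mpolys B) \<Longrightarrow> prod p I \<in> mpolys (B :: 'v set)"
  for p :: "'i \<Rightarrow> ('v, 'c::comm_semiring_1) mpoly"
  by (induction I rule: infinite_finite_induct) (auto intro: mult_mpolys)

lemma power_mpolys: "p \<in> mpolys B \<Longrightarrow> p ^ n \<in> mpolys (B :: 'v set)"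
  for p :: "('v, 'c::comm_semiring_1) mpoly"
  by (induction n) (auto intro: mult_mpolys)

context
  fixes sM :: "'k::field \<Rightarrow> 'm::ab_group_add \<Rightarrow> 'm"
  assumes M: "vector_space sM"
begin

interpretation M: vector_space sM by (rule M)

lemma lookup_tensor: "Poly_Mapping.lookup (tensor sM f m) \<alpha> = sM (Poly_Mapping.lookup f \<alpha>) m"
  by (auto simp: tensor_def Poly_Mapping.map.rep_eq when_def)

lemma tensor_add_left: "tensor sM (f + h) m = tensor sM f m + tensor sM h m"
  and tensor_add_right: "tensor sM f (m + n) = tensor sM f m + tensor sM f n"
  and tensor_zero_left [simp]: "tensor sM 0 m = 0"
  and tensor_zero_right [simp]: "tensor sM f 0 = 0"
  and tensor_single: "tensor sM (Poly_Mapping.single \<alpha> a) m = Poly_Mapping.single \<alpha> (sM a m)"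
  by (rule poly_mapping_eqI; 
      simp add: lookup_tensor lookup_add M.scale_left_distrib M.scale_right_distrib
        lookup_single when_def)+

lemma tensor_scale: "tensor sM f (sM a m) = tensor sM (Poly_Mapping.single 0 a * f) m"
proof (rule poly_mapping_eqI)
  fix \<alpha>
  have "Poly_Mapping.lookup (Poly_Mapping.single 0 a * f) \<alpha> = a * Poly_Mapping.lookup f \<alpha>"
    by (simp add: Poly_Mapping.map.rep_eq when_def flip: mult_map_scale_conv_mult)
  then show "Poly_Mapping.lookup (tensor sM f (sM a m)) \<alpha> =
      Poly_Mapping.lookup (tensor sM (Poly_Mapping.single 0 a * f) m) \<alpha>"
    by (simp add: lookup_tensor mult.commute)
qed

lemma tensor_mpolys: "f \<in> mpolys B \<Longrightarrow> tensor sM f m \<in> mpolys B"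
  by (force simp: mpolys_def in_keys_iff lookup_tensor)

lemma tensor_expansion:
  "t = (\<Sum>\<alpha>\<in>Poly_Mapping.keys t. tensor sM (Poly_Mapping.single \<alpha> 1) (Poly_Mapping.lookup t \<alpha>))"
  by (simp add: tensor_single flip: poly_mapping_sum_single)

lemma poly_smult_add_left: "poly_smult sM (f + h) t = poly_smult sM f t + poly_smult sM h t"
  by (simp add: poly_smult_def distrib_right tensor_add_left sum.distrib)

lemma poly_smult_add_right: "poly_smult sM f (t + u) = poly_smult sM f t + poly_smult sM f u"
  unfolding poly_smult_def by (rule sum_keys_add) (auto simp: tensor_add_right)

lemma poly_smult_single:
  "poly_smult sM f (Poly_Mapping.single \<alpha> m) = tensor sM (f * Poly_Mapping.single \<alpha> 1) m"
  by (simp add: poly_smult_def)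

lemma poly_smult_tensor: "poly_smult sM f (tensor sM h m) = tensor sM (f * h) m"
proof (induction h rule: poly_mapping_add_induct)
  case (single \<alpha> a)
  have "tensor sM (f * Poly_Mapping.single \<alpha> 1) (sM a m) = tensor sM (f * Poly_Mapping.single \<alpha> a) m"
    by (simp add: tensor_scale mult.left_commute mult_single)
  then show ?case by (simp add: tensor_single poly_smult_single)
qed (simp add: tensor_add_left distrib_left poly_smult_add_right)

lemma poly_smult_mult: "poly_smult sM (f * h) t = poly_smult sM f (poly_smult sM h t)"
  by (induction t rule: poly_mapping_add_induct)
    (simp_all add: poly_smult_single poly_smult_tensor poly_smult_add_right mult.assoc)

lemma poly_smult_one: "poly_smult sM 1 t = t"
  by (simp add: poly_smult_def flip: tensor_expansion)

lemma poly_smult_mpolys: "f \<in> mpolys B \<Longrightarrow> t \<in> mpolys B \<Longrightarrow> poly_smult sM f t \<in> mpolys B"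
  unfolding poly_smult_def
  by (intro sum_mpolys tensor_mpolys mult_mpolys) (auto simp: single_mpolys, auto simp: mpolys_def)

lemma tensor_universal:
  fixes sN :: "'k \<Rightarrow> 'n::ab_group_add \<Rightarrow> 'n" and \<beta> :: "('v, 'k) mpoly \<Rightarrow> 'm \<Rightarrow> 'n"
  assumes N: "vector_space sN"
    and add_left: "\<And>f h m. f \<in> mpolys B \<Longrightarrow> h \<in> mpolys B \<Longrightarrow> \<beta> (f + h) m = \<beta> f m + \<beta> h m"
    and add_right: "\<And>f m n. f \<in> mpolys B \<Longrightarrow> \<beta> f (m + n) = \<beta> f m + \<beta> f n"
    and scale_left: "\<And>a f m. f \<in> mpolys B \<Longrightarrow> \<beta> (Poly_Mapping.single 0 a * f) m = sN a (\<beta> f m)"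
    and scale_right: "\<And>a f m. f \<in> mpolys B \<Longrightarrow> \<beta> f (sM a m) = sN a (\<beta> f m)"
  shows "\<exists>!L. L \<in> extensional (mpolys B) \<and>
            (\<forall>t\<in>mpolys B. \<forall>u\<in>mpolys B. L (t + u) = L t + L u) \<and>
            (\<forall>a. \<forall>t\<in>mpolys B. L (poly_smult sM (Poly_Mapping.single 0 a) t) = sN a (L t)) \<and>
            (\<forall>f\<in>mpolys B. \<forall>m. L (tensor sM f m) = \<beta> f m)" (is "\<exists>!L. ?P L")
proof -
  interpret N: vector_space sN by (rule N)
  define X where "X = (\<lambda>\<alpha>. Poly_Mapping.single \<alpha> 1 :: ('v, 'k) mpoly)"
  have X: "X \<alpha> \<in> mpolys B" if "Poly_Mapping.keys \<alpha> \<subseteq> B" for \<alpha>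
    using that by (simp add: X_def single_mpolys)
  define \<phi> where "\<phi> = (\<lambda>\<alpha> m. if Poly_Mapping.keys \<alpha> \<subseteq> B then \<beta> (X \<alpha>) m else 0)"
  have \<phi>_add: "\<phi> \<alpha> (m + n) = \<phi> \<alpha> m + \<phi> \<alpha> n" for \<alpha> m n
    by (simp add: \<phi>_def add_right X)
  have \<phi>_0: "\<phi> \<alpha> 0 = 0" for \<alpha> using \<phi>_add[of \<alpha> 0 0] by simp
  define E where "E = (\<lambda>t. \<Sum>\<alpha>\<in>Poly_Mapping.keys t. \<phi> \<alpha> (Poly_Mapping.lookup t \<alpha>))"
  have E_add: "E (t + u) = E t + E u" for t u
    unfolding E_def by (rule sum_keys_add) (auto simp: \<phi>_0 \<phi>_add)
  have E_single: "E (Poly_Mapping.single \<alpha> m) = \<phi> \<alpha> m" for \<alpha> m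
    by (simp add: E_def \<phi>_0)
  have E_0: "E 0 = 0" by (simp add: E_def)
  have E_sum: "E (sum g I) = (\<Sum>i\<in>I. E (g i))" for g and I :: "('v \<Rightarrow>\<^sub>0 nat) set"
    by (induction I rule: infinite_finite_induct) (auto simp: E_0 E_add)
  have \<beta>_0: "\<beta> 0 m = 0" for m using add_left[of 0 0 m] by simp
  have \<beta>_sum: "\<beta> (sum g I) m = (\<Sum>i\<in>I. \<beta> (g i) m)" if "\<And>i. i \<in> I \<Longrightarrow> g i \<in> mpolys B"
    for g m and I :: "('v \<Rightarrow>\<^sub>0 nat) set" using that
    by (induction I rule: infinite_finite_induct) (auto simp: \<beta>_0 add_left sum_mpolys)
  have keysB: "Poly_Mapping.keys \<alpha> \<subseteq> B" if "\<alpha> \<in> Poly_Mapping.keys t" "t \<in> mpolys B" for \<alpha> and t :: "('v, 'c::zero) mpoly"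
    using that by (auto simp: mpolys_def)
  have E_tensor: "E (tensor sM f m) = \<beta> f m" if f: "f \<in> mpolys B" for f m
  proof -
    let ?s = "\<lambda>\<alpha>. Poly_Mapping.single \<alpha> (Poly_Mapping.lookup f \<alpha>)"
    have ten_sum: "tensor sM (sum g I) m = (\<Sum>i\<in>I. tensor sM (g i) m)" for g and I :: "('v \<Rightarrow>\<^sub>0 nat) set"
      by (induction I rule: infinite_finite_induct) (auto simp: tensor_add_left)
    have "E (tensor sM f m) = E (tensor sM (\<Sum>\<alpha>\<in>Poly_Mapping.keys f. ?s \<alpha>) m)"
      by (simp flip: poly_mapping_sum_single)
    also have "\<dots> = (\<Sum>\<alpha>\<in>Poly_Mapping.keys f. \<phi> \<alpha> (sM (Poly_Mapping.lookup f \<alpha>) m))"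
      by (simp add: ten_sum E_sum tensor_single E_single)
    also have "\<dots> = (\<Sum>\<alpha>\<in>Poly_Mapping.keys f. \<beta> (?s \<alpha>) m)"
    proof (rule sum.cong)
      fix \<alpha> assume "\<alpha> \<in> Poly_Mapping.keys f"
      with f have *: "Poly_Mapping.keys \<alpha> \<subseteq> B" by (rule keysB[rotated])
      have "\<beta> (?s \<alpha>) m = \<beta> (Poly_Mapping.single 0 (Poly_Mapping.lookup f \<alpha>) * X \<alpha>) m"
        by (simp add: X_def mult_single)
      with * show "\<phi> \<alpha> (sM (Poly_Mapping.lookup f \<alpha>) m) = \<beta> (?s \<alpha>) m"
        by (simp add: \<phi>_def X scale_left scale_right)
    qed simp
    also have "\<dots> = \<beta> (\<Sum>\<alpha>\<in>Poly_Mapping.keys f. ?s \<alpha>) m"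
      using f by (intro \<beta>_sum [symmetric]) (auto simp: single_mpolys mpolys_def)
    finally show ?thesis by (simp flip: poly_mapping_sum_single)
  qed
  have \<phi>_scale: "\<phi> \<alpha> (sM a m) = sN a (\<phi> \<alpha> m)" for \<alpha> a m
    by (simp add: \<phi>_def scale_right X)
  have E_scale: "E (poly_smult sM (Poly_Mapping.single 0 a) t) = sN a (E t)" for a t
    by (induction t rule: poly_mapping_add_induct)
      (simp_all add: poly_smult_single mult_single tensor_single E_single \<phi>_scale
        poly_smult_add_right E_add N.scale_right_distrib)
  show ?thesis
  proof (rule ex1I[of _ "restrict E (mpolys B)"])
    have "Poly_Mapping.single 0 a \<in> mpolys B" for a :: 'k
      by (simp add: single_mpolys)
    then show "?P (restrict E (mpolys B))"
      by (simp add: add_mpolys E_add poly_smult_mpolys E_scale tensor_mpolys E_tensor)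
  next
    fix L assume L: "?P L"
    have L0: "L 0 = 0" using L zero_mpolys[of B] by (metis add_cancel_right_right add.right_neutral)
    have L_sum: "L (sum g I) = (\<Sum>i\<in>I. L (g i))" if "\<And>i. i \<in> I \<Longrightarrow> g i \<in> mpolys B"
      for g and I :: "('v \<Rightarrow>\<^sub>0 nat) set" using that
      by (induction I rule: infinite_finite_induct) (use L in \<open>auto simp: L0 sum_mpolys\<close>)
    show "L = restrict E (mpolys B)"
    proof (rule extensionalityI[of _ "mpolys B"])
      fix t :: "('v, 'm) mpoly" assume t: "t \<in> mpolys B"
      have "L t = L (\<Sum>\<alpha>\<in>Poly_Mapping.keys t. tensor sM (X \<alpha>) (Poly_Mapping.lookup t \<alpha>))"
        unfolding X_def by (simp flip: tensor_expansion)
      also have "\<dots> = (\<Sum>\<alpha>\<in>Poly_Mapping.keys t. \<beta> (X \<alpha>) (Poly_Mapping.lookup t \<alpha>))"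
        using L by (subst L_sum) (auto intro!: tensor_mpolys X keysB[OF _ t] sum.cong)
      also have "\<dots> = E t"
        unfolding E_def by (rule sum.cong) (auto simp: \<phi>_def dest: keysB[OF _ t])
      finally show "L t = restrict E (mpolys B) t" using t by simp
    qed (use L in auto)
  qed
qed

end

context
  fixes s :: "'k::field \<Rightarrow> 'v::ab_group_add \<Rightarrow> 'v" and B :: "'v set"
  assumes V: "finite_dimensional_vector_space s B"
begin

interpretation V: finite_dimensional_vector_space s B by (rule V)

lemma coord_act_mpolys: "coord_act s B g b \<in> mpolys B"
  unfolding coord_act_def by (intro sum_mpolys) (auto simp: single_mpolys)

lemma poly_act_add: "poly_act s B g (f + h) = poly_act s B g f + poly_act s B g h"
  unfolding poly_act_def by (rule sum_keys_add) (auto simp: single_add distrib_right)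

lemma poly_act_single:
  "poly_act s B g (Poly_Mapping.single \<alpha> a) =
     Poly_Mapping.single 0 a * (\<Prod>b\<in>Poly_Mapping.keys \<alpha>. coord_act s B g b ^ Poly_Mapping.lookup \<alpha> b)"
  by (simp add: poly_act_def)

lemma poly_act_const: "poly_act s B g (Poly_Mapping.single 0 a) = Poly_Mapping.single 0 a"
  by (simp add: poly_act_single)

lemma poly_act_var:
  "poly_act s B g (Poly_Mapping.single (Poly_Mapping.single b 1) 1) = coord_act s B g b"
  by (simp add: poly_act_single)

lemma poly_act_mult: "poly_act s B g (f * h) = poly_act s B g f * poly_act s B g h"
proof (induction f rule: poly_mapping_add_induct)
  case (single \<alpha> a)
  let ?p = "\<lambda>\<alpha> A. \<Prod>b\<in>A. coord_act s B g b ^ Poly_Mapping.lookup \<alpha> b"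
  show ?case
  proof (induction h rule: poly_mapping_add_induct)
    case (single \<beta> b)
    let ?A = "Poly_Mapping.keys \<alpha> \<union> Poly_Mapping.keys \<beta>"
    have "?p \<alpha> (Poly_Mapping.keys \<alpha>) = ?p \<alpha> ?A" "?p \<beta> (Poly_Mapping.keys \<beta>) = ?p \<beta> ?A"
      by (auto intro!: prod.mono_neutral_left simp: in_keys_iff)
    moreover have "?p (\<alpha> + \<beta>) ?A = ?p \<alpha> ?A * ?p \<beta> ?A"
      by (simp add: lookup_add power_add prod.distrib)
    moreover have "Poly_Mapping.single 0 (a * b) =
        (Poly_Mapping.single 0 a * Poly_Mapping.single 0 b :: ('v, 'k) mpoly)"
      by (simp add: mult_single)
    ultimately show ?case
      by (subst mult_single) (simp only: poly_act_single keys_monom_add mult_ac)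
  qed (simp add: distrib_left poly_act_add)
qed (simp add: distrib_right poly_act_add)

lemma poly_act_one: "poly_act s B g 1 = 1"
  using poly_act_const[of g 1] by simp

lemma poly_act_0: "poly_act s B g 0 = 0"
  by (simp add: poly_act_def)

lemma poly_act_uminus: "poly_act s B g (- f) = - poly_act s B g f"
  using poly_act_add[of g f "- f"] by (simp add: poly_act_0 eq_neg_iff_add_eq_0 add.commute)

lemma poly_act_power: "poly_act s B g (f ^ n) = poly_act s B g f ^ n"
  by (induction n) (simp_all add: poly_act_one poly_act_mult)

lemma poly_act_prod: "poly_act s B g (prod f I) = (\<Prod>i\<in>I. poly_act s B g (f i))"
  by (induction I rule: infinite_finite_induct) (simp_all add: poly_act_one poly_act_mult)

lemma poly_act_sum: "poly_act s B g (sum f I) = (\<Sum>i\<in>I. poly_act s B g (f i))"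
  by (induction I rule: infinite_finite_induct) (simp_all add: poly_act_0 poly_act_add)

lemma poly_act_mpolys: "f \<in> mpolys B \<Longrightarrow> poly_act s B g f \<in> mpolys B"
  unfolding poly_act_def
  by (intro sum_mpolys mult_mpolys prod_mpolys power_mpolys coord_act_mpolys) (simp add: single_mpolys)

lemma coord_act_id:
  assumes "b \<in> B"
  shows "coord_act s B id b = Poly_Mapping.single (Poly_Mapping.single b 1) 1"
proof -
  have "coord_act s B id b = (\<Sum>c\<in>B. if c = b then Poly_Mapping.single (Poly_Mapping.single b 1) 1 else 0)"
    unfolding coord_act_def using assms
    by (intro sum.cong) (auto simp: V.representation_basis V.independent_Basis)
  then show ?thesis using assms V.finite_Basis by simp
qed

lemma coord_act_comp:
  assumes g: "g \<in> carrier (general_linear s)" and h: "h \<in> carrier (general_linear s)"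
  shows "poly_act s B g (coord_act s B h b) = coord_act s B (g \<circ> h) b"
proof -
  let ?r = "V.representation B" and ?X = "\<lambda>c. Poly_Mapping.single c 1 :: 'v \<Rightarrow>\<^sub>0 nat"
  let ?g' = "inv_into UNIV g" and ?h' = "inv_into UNIV h"
  have bij: "bij g" "bij h" and lin: "Vector_Spaces.linear s s h"
    using g h by (auto simp: general_linear_def)
  have lin': "Vector_Spaces.linear s s ?h'"
  proof -
    interpret h: Vector_Spaces.linear s s h by (rule lin)
    have hh: "h (?h' x) = x" "?h' (h x) = x" for x
      using bij(2) by (auto simp: bij_def surj_f_inv_f)
    show ?thesis
      by unfold_locales (metis hh h.add, metis hh h.scale)
  qed
  interpret h': Vector_Spaces.linear s s ?h' by (rule lin')
  have sp: "x \<in> V.span B" for x by (simp add: V.span_Basis)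
  have rep: "x = (\<Sum>c\<in>B. s (?r x c) c)" for x
    using V.sum_representation_eq[OF V.independent_Basis sp V.finite_Basis subset_refl] by simp
  have rh: "?r (?h' x) b = (\<Sum>c\<in>B. ?r x c * ?r (?h' c) b)" for x
  proof -
    have "?r (?h' x) b = ?r (\<Sum>c\<in>B. s (?r x c) (?h' c)) b"
      by (subst rep[of x]) (simp add: h'.sum h'.scale)
    also have "\<dots> = (\<Sum>c\<in>B. ?r x c * ?r (?h' c) b)"
      by (simp add: V.representation_sum[OF V.independent_Basis] V.representation_scale[OF V.independent_Basis] sp)
    finally show ?thesis .
  qed
  have "poly_act s B g (coord_act s B h b) =
      (\<Sum>c\<in>B. Poly_Mapping.single 0 (?r (?h' c) b) * coord_act s B g c)"
    by (simp add: coord_act_def[of s B h] poly_act_sum poly_act_single)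
  also have "\<dots> = (\<Sum>c\<in>B. \<Sum>d\<in>B. Poly_Mapping.single (?X d) (?r (?g' d) c * ?r (?h' c) b))"
    by (simp add: coord_act_def sum_distrib_left mult_single mult.commute)
  also have "\<dots> = (\<Sum>d\<in>B. \<Sum>c\<in>B. Poly_Mapping.single (?X d) (?r (?g' d) c * ?r (?h' c) b))"
    by (rule sum.swap)
  also have "\<dots> = (\<Sum>d\<in>B. Poly_Mapping.single (?X d) (?r (?h' (?g' d)) b))"
  proof (rule sum.cong)
    fix d
    have "(\<Sum>c\<in>C. Poly_Mapping.single (?X d) (f c)) = Poly_Mapping.single (?X d) (sum f C)"
      for C and f :: "'v \<Rightarrow> 'k"
      by (induction C rule: infinite_finite_induct) (auto simp: single_add)
    then show "(\<Sum>c\<in>B. Poly_Mapping.single (?X d) (?r (?g' d) c * ?r (?h' c) b)) =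
        Poly_Mapping.single (?X d) (?r (?h' (?g' d)) b)"
      by (simp add: rh[of "?g' d"])
  qed simp
  also have "\<dots> = coord_act s B (g \<circ> h) b"
    using bij by (simp add: coord_act_def o_inv_distrib)
  finally show ?thesis .
qed

lemma poly_act_comp:
  assumes "g \<in> carrier (general_linear s)" "h \<in> carrier (general_linear s)"
  shows "poly_act s B (g \<circ> h) f = poly_act s B g (poly_act s B h f)"
  by (induction f rule: poly_mapping_add_induct)
    (simp_all add: poly_act_add poly_act_single poly_act_mult poly_act_prod poly_act_power
      poly_act_const coord_act_comp[OF assms, unfolded o_def] o_def)

lemma poly_act_id:
  assumes "f \<in> mpolys B"
  shows "poly_act s B id f = f"
proof -
  have X: "(\<Prod>b\<in>A. Poly_Mapping.single (Poly_Mapping.single b 1) 1 ^ n b) =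
      (Poly_Mapping.single (\<Sum>b\<in>A. Poly_Mapping.single b (n b)) 1 :: ('v, 'k) mpoly)" for A n
  proof (induction A rule: infinite_finite_induct)
    case (insert b A)
    have "Poly_Mapping.single (Poly_Mapping.single b 1) 1 ^ k =
       (Poly_Mapping.single (Poly_Mapping.single b k) 1 :: ('v, 'k) mpoly)" for k
      by (induction k) (auto simp: mult_single simp flip: single_add)
    with insert show ?case by (simp add: mult_single)
  qed auto
  have "poly_act s B id f = (\<Sum>\<alpha>\<in>Poly_Mapping.keys f. Poly_Mapping.single \<alpha> (Poly_Mapping.lookup f \<alpha>))"
    unfolding poly_act_def
  proof (rule sum.cong)
    fix \<alpha> assume "\<alpha> \<in> Poly_Mapping.keys f"
    then have \<alpha>: "Poly_Mapping.keys \<alpha> \<subseteq> B" using assms by (auto simp: mpolys_def)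
    have "(\<Prod>b\<in>Poly_Mapping.keys \<alpha>. coord_act s B id b ^ Poly_Mapping.lookup \<alpha> b) =
       (\<Prod>b\<in>Poly_Mapping.keys \<alpha>. Poly_Mapping.single (Poly_Mapping.single b 1) 1 ^ Poly_Mapping.lookup \<alpha> b)"
      using \<alpha> by (intro prod.cong) (auto simp: coord_act_id)
    also have "\<dots> = Poly_Mapping.single \<alpha> 1"
      unfolding X by (simp flip: poly_mapping_sum_single)
    finally show "Poly_Mapping.single 0 (Poly_Mapping.lookup f \<alpha>) *
        (\<Prod>b\<in>Poly_Mapping.keys \<alpha>. coord_act s B id b ^ Poly_Mapping.lookup \<alpha> b) =
        Poly_Mapping.single \<alpha> (Poly_Mapping.lookup f \<alpha>)"
      by (simp add: mult_single)
  qed simp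
  then show ?thesis by (simp flip: poly_mapping_sum_single)
qed

lemma cring_invariant_ring: "cring (invariant_ring s B H)"
proof (rule cringI)
  show "abelian_group (invariant_ring s B H)"
  proof (rule abelian_groupI)
    fix x assume "x \<in> carrier (invariant_ring s B H)"
    then show "\<exists>y\<in>carrier (invariant_ring s B H).
        y \<oplus>\<^bsub>invariant_ring s B H\<^esub> x = \<zero>\<^bsub>invariant_ring s B H\<^esub>"
      by (intro bexI[of _ "- x"]) (auto simp: invariant_ring_def uminus_mpolys poly_act_uminus)
  qed (auto simp: invariant_ring_def add_mpolys poly_act_add poly_act_0 add_ac)
  show "Group.comm_monoid (invariant_ring s B H)"
    by (rule comm_monoidI) (auto simp: invariant_ring_def mult_mpolys poly_act_mult poly_act_one mult_ac)
qed (auto simp: invariant_ring_def distrib_right)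

context
  fixes sM :: "'k \<Rightarrow> 'm::ab_group_add \<Rightarrow> 'm" and G :: "('v \<Rightarrow> 'v) set"
    and \<rho> :: "('v \<Rightarrow> 'v) \<Rightarrow> 'm \<Rightarrow> 'm"
  assumes M: "vector_space sM"
    and \<rho>: "\<rho> \<in> hom (general_linear s\<lparr>carrier := G\<rparr>) (general_linear sM)"
begin

interpretation M: vector_space sM by (rule M)

lemma tensor_act_single:
  assumes "g \<in> G"
  shows "tensor_act s B sM \<rho> g (Poly_Mapping.single \<alpha> m) =
    tensor sM (poly_act s B g (Poly_Mapping.single \<alpha> 1)) (\<rho> g m)"
proof -
  interpret Vector_Spaces.linear sM sM "\<rho> g"
    using \<rho> assms by (auto simp: hom_def general_linear_def)
  show ?thesis by (simp add: tensor_act_def tensor_zero_right[OF M])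
qed

lemma tensor_act_add:
  assumes "g \<in> G"
  shows "tensor_act s B sM \<rho> g (t + u) = tensor_act s B sM \<rho> g t + tensor_act s B sM \<rho> g u"
proof -
  interpret Vector_Spaces.linear sM sM "\<rho> g"
    using \<rho> assms by (auto simp: hom_def general_linear_def)
  show ?thesis
    unfolding tensor_act_def
    by (rule sum_keys_add) (auto simp: tensor_zero_right[OF M] add tensor_add_right[OF M])
qed

lemma tensor_act_tensor:
  assumes "g \<in> G"
  shows "tensor_act s B sM \<rho> g (tensor sM f m) = tensor sM (poly_act s B g f) (\<rho> g m)"
proof (induction f rule: poly_mapping_add_induct)
  case (single \<alpha> a)
  interpret Vector_Spaces.linear sM sM "\<rho> g"
    using \<rho> assms by (auto simp: hom_def general_linear_def)
  show ?case
    by (simp add: tensor_single[OF M] tensor_act_single[OF assms] scale tensor_scale[OF M]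
        poly_act_single)
qed (simp add: tensor_add_left[OF M] tensor_act_add[OF assms] poly_act_add)

lemma tensor_act_smult:
  assumes "g \<in> G"
  shows "tensor_act s B sM \<rho> g (poly_smult sM f t) =
    poly_smult sM (poly_act s B g f) (tensor_act s B sM \<rho> g t)"
  by (induction t rule: poly_mapping_add_induct)
    (simp_all add: poly_smult_single[OF M] tensor_act_tensor[OF assms] tensor_act_single[OF assms]
      poly_smult_tensor[OF M] poly_act_mult poly_smult_add_right[OF M] tensor_act_add[OF assms])

lemma tensor_act_comp:
  assumes "g \<in> G" "h \<in> G" "G \<subseteq> carrier (general_linear s)" "g \<circ> h \<in> G"
  shows "tensor_act s B sM \<rho> (g \<circ> h) t = tensor_act s B sM \<rho> g (tensor_act s B sM \<rho> h t)"
proof -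
  have "\<rho> (g \<circ> h) = \<rho> g \<circ> \<rho> h"
    using \<rho> assms by (simp add: hom_def general_linear_def)
  moreover have "poly_act s B (g \<circ> h) f = poly_act s B g (poly_act s B h f)" for f
    using assms by (intro poly_act_comp) auto
  ultimately show ?thesis
    using assms by (induction t rule: poly_mapping_add_induct)
      (simp_all add: tensor_act_single tensor_act_tensor tensor_act_add)
qed

lemma module_covariants:
  assumes "H \<subseteq> G"
  shows "Module.module (invariant_ring s B H) (covariants s B sM \<rho> H)"
proof (rule moduleI)
  have HG: "g \<in> G" if "g \<in> H" for g using that assms by auto
  have act_0: "tensor_act s B sM \<rho> g 0 = 0" for g by (simp add: tensor_act_def)
  have act_uminus: "tensor_act s B sM \<rho> g (- t) = - tensor_act s B sM \<rho> g t" if "g \<in> H" for g t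
    using tensor_act_add[OF HG[OF that], of t "- t"]
    by (simp add: act_0 eq_neg_iff_add_eq_0 add.commute)
  show "cring (invariant_ring s B H)" by (rule cring_invariant_ring)
  show "abelian_group (covariants s B sM \<rho> H)"
  proof (rule abelian_groupI)
    fix x assume "x \<in> carrier (covariants s B sM \<rho> H)"
    then show "\<exists>y\<in>carrier (covariants s B sM \<rho> H).
        y \<oplus>\<^bsub>covariants s B sM \<rho> H\<^esub> x = \<zero>\<^bsub>covariants s B sM \<rho> H\<^esub>"
      by (intro bexI[of _ "- x"]) (auto simp: covariants_def uminus_mpolys act_uminus)
  qed (auto simp: covariants_def add_mpolys tensor_act_add HG act_0 add_ac)
qed (auto simp: covariants_def invariant_ring_def poly_smult_mpolys[OF M]
    tensor_act_smult assms[THEN subsetD] poly_smult_add_left[OF M]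
    poly_smult_add_right[OF M] poly_smult_mult[OF M] poly_smult_one[OF M])

end

end

end

theory Submission
  imports Defs "Jordan_Normal_Form.Char_Poly"
begin

text \<open>
  Write \<open>S\<close> for \<open>k[V]\<close>.  Everything is compared inside the free \<open>S\<close>-module \<open>S \<otimes> M\<close>, by two
  facts about a finite group \<open>H\<close>.  Covariants of \<open>H\<close> that are independent over the invariants
  \<open>S\<^sup>H\<close> remain independent over \<open>S\<close> (\<open>indep_extends\<close>).  If a covariant of \<open>H\<close> is an \<open>S\<close>-linear
  combination of independent covariants of \<open>H\<close>, then its coefficients lie in \<open>S\<^sup>H\<close>
  (\<open>rspan_descend\<close>).  Hence a set of covariants of \<open>G\<close> that is independent over \<open>S\<close> is a basis
  for \<open>G\<close>, or for \<open>K\<close>, as soon as its \<open>S\<close>-span contains the covariants of \<open>G\<close>, or of \<open>K\<close>.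

  From \<open>K\<close> to \<open>G\<close> it remains to find a basis for \<open>K\<close> that consists of covariants of \<open>G\<close>.  The
  homogeneous components of the shared generators are again covariants of \<open>G\<close>, and by the graded
  version of Nakayama's lemma homogeneous generators of a free module contain a basis
  (\<open>homogeneous_generators_contain_basis\<close>).

  From \<open>G\<close> to \<open>K\<close> let \<open>E\<close> be a basis for \<open>G\<close> and \<open>t\<close> a covariant of \<open>K\<close>; it has to be shown that
  \<open>t\<close> lies in the \<open>S\<close>-span of \<open>E\<close> (\<open>Cov_subset_span\<close>).  For \<open>w \<in> S\<^sup>K\<close> the relative trace of \<open>w t\<close> is
  a covariant of \<open>G\<close>.  A suitable \<open>S\<close>-linear combination of such traces is \<open>D t\<close>, where \<open>D\<close> is the
  product of the differences \<open>g y\<^sub>g - y\<^sub>g\<close> over all \<open>g \<in> G - K\<close>, for any choice of \<open>y\<^sub>g \<in> S\<^sup>K\<close>.  The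
  same construction for the trivial subgroup instead of \<open>K\<close> shows that some product of linear
  forms multiplies \<open>t\<close> into the span.  Linear forms are prime, so a linear form \<open>l\<close> can be
  cancelled from this product if \<open>l\<close> does not divide some \<open>D\<close>.  If \<open>l\<close> divided every \<open>D\<close>, then some
  \<open>g \<in> G - K\<close> would act trivially on \<open>S\<^sup>K\<close> modulo \<open>l\<close>.  Comparing the polynomials whose roots are the
  \<open>K\<close>-orbit of an element, one finds \<open>k \<in> K\<close> such that \<open>g k\<close> acts trivially on \<open>S\<close> modulo \<open>l\<close>
  (\<open>congruent_on_invariants\<close>).  Then \<open>g k\<close> fixes the hyperplane \<open>l = 0\<close> point-wise, so it lies in
  \<open>W \<subseteq> K\<close>, contrary to \<open>g \<notin> K\<close>.  In other words, \<open>S\<^sup>K\<close> is unramified over \<open>S\<^sup>G\<close> in codimension one.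
\<close>

section \<open>Substitution homomorphisms\<close>

abbreviation const :: "'k::zero \<Rightarrow> ('v, 'k) mpoly" where
  "const \<equiv> Poly_Mapping.single 0"

abbreviation var :: "'v \<Rightarrow> ('v, 'k::zero_neq_one) mpoly" where
  "var b \<equiv> Poly_Mapping.single (Poly_Mapping.single b (Suc 0)) 1"

lemma comm_ring_hom_const: "comm_ring_hom (const :: 'k::comm_ring_1 \<Rightarrow> ('v, 'k) mpoly)"
  by unfold_locales (auto simp: single_add mult_single)

lemma comm_ring_hom_compose:
  assumes "comm_ring_hom f" "comm_ring_hom g"
  shows "comm_ring_hom (\<lambda>x. f (g x))"
proof -
  interpret f: comm_ring_hom f by fact
  interpret g: comm_ring_hom g by fact
  show ?thesis by unfold_locales (simp_all add: f.hom_add g.hom_add f.hom_mult g.hom_mult)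
qed

lemma single_monomial_eq_prod:
  "Poly_Mapping.single \<alpha> (a :: 'k::comm_ring_1) =
     const a * (\<Prod>b\<in>Poly_Mapping.keys \<alpha>. var b ^ Poly_Mapping.lookup \<alpha> b)"
proof -
  have pow: "var b ^ n = (Poly_Mapping.single (Poly_Mapping.single b n) 1 :: ('v, 'k) mpoly)" for b n
    by (induction n) (auto simp: mult_single simp flip: single_add)
  have "(\<Prod>b\<in>A. var b ^ n b) =
      (Poly_Mapping.single (\<Sum>b\<in>A. Poly_Mapping.single b (n b)) 1 :: ('v, 'k) mpoly)" for A n
    by (induction A rule: infinite_finite_induct) (simp_all add: pow mult_single)
  note * = this[of "Poly_Mapping.lookup \<alpha>" "Poly_Mapping.keys \<alpha>"]
  show ?thesis unfolding * poly_mapping_sum_single[of \<alpha>, symmetric] by (simp add: mult_single)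
qed

lemma mpolys_induct [consumes 1, case_names const var add mult]:
  fixes f :: "('v, 'k::comm_ring_1) mpoly"
  assumes f: "f \<in> mpolys B"
    and c: "\<And>a. P (const a)" and v: "\<And>b. b \<in> B \<Longrightarrow> P (var b)"
    and a: "\<And>f h. P f \<Longrightarrow> P h \<Longrightarrow> P (f + h)" and m: "\<And>f h. P f \<Longrightarrow> P h \<Longrightarrow> P (f * h)"
  shows "P f"
proof -
  have zero: "P 0" and one: "P 1" using c[of 0] c[of 1] by simp_all
  have pow: "P (x ^ n)" if "P x" for x n by (induction n) (auto intro: m one that)
  have prod: "P (prod x A)" if "\<And>i. i \<in> A \<Longrightarrow> P (x i)" for x and A :: "'v set"
    using that by (induction A rule: infinite_finite_induct) (auto intro: m one)
  have sum: "P (sum x A)" if "\<And>i. i \<in> A \<Longrightarrow> P (x i)" for x and A :: "('v \<Rightarrow>\<^sub>0 nat) set"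
    using that by (induction A rule: infinite_finite_induct) (auto intro: a zero)
  have "P (\<Sum>\<alpha>\<in>Poly_Mapping.keys f. Poly_Mapping.single \<alpha> (Poly_Mapping.lookup f \<alpha>))"
    using f by (intro sum, subst single_monomial_eq_prod) (auto intro!: m c prod pow v simp: mpolys_def)
  then show ?thesis by (simp flip: poly_mapping_sum_single)
qed

definition eval_mpoly :: "('k::comm_ring_1 \<Rightarrow> 'r::comm_ring_1) \<Rightarrow> ('v \<Rightarrow> 'r) \<Rightarrow> ('v, 'k) mpoly \<Rightarrow> 'r" where
  "eval_mpoly C \<sigma> f = (\<Sum>\<alpha>\<in>Poly_Mapping.keys f. C (Poly_Mapping.lookup f \<alpha>) *
     (\<Prod>b\<in>Poly_Mapping.keys \<alpha>. \<sigma> b ^ Poly_Mapping.lookup \<alpha> b))"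

context
  fixes C :: "'k::comm_ring_1 \<Rightarrow> 'r::comm_ring_1"
  assumes C: "comm_ring_hom C"
begin

interpretation C: comm_ring_hom C by (rule C)

lemma eval_mpoly_single:
  "eval_mpoly C \<sigma> (Poly_Mapping.single \<alpha> a) =
     C a * (\<Prod>b\<in>Poly_Mapping.keys \<alpha>. \<sigma> b ^ Poly_Mapping.lookup \<alpha> b)"
  by (simp add: eval_mpoly_def)

lemma eval_mpoly_const: "eval_mpoly C \<sigma> (const a) = C a"
  and eval_mpoly_var: "eval_mpoly C \<sigma> (var b) = \<sigma> b"
  by (simp_all add: eval_mpoly_single)

lemma eval_mpoly_add: "eval_mpoly C \<sigma> (f + h) = eval_mpoly C \<sigma> f + eval_mpoly C \<sigma> h"
  unfolding eval_mpoly_def by (rule sum_keys_add) (auto simp: C.hom_add distrib_right)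

lemma eval_mpoly_mult: "eval_mpoly C \<sigma> (f * h) = eval_mpoly C \<sigma> f * eval_mpoly C \<sigma> h"
proof (induction f rule: poly_mapping_add_induct)
  case (single \<alpha> a)
  let ?p = "\<lambda>\<alpha> A. \<Prod>b\<in>A. \<sigma> b ^ Poly_Mapping.lookup \<alpha> b"
  show ?case
  proof (induction h rule: poly_mapping_add_induct)
    case (single \<beta> b)
    let ?A = "Poly_Mapping.keys \<alpha> \<union> Poly_Mapping.keys \<beta>"
    have "?p \<alpha> (Poly_Mapping.keys \<alpha>) = ?p \<alpha> ?A" "?p \<beta> (Poly_Mapping.keys \<beta>) = ?p \<beta> ?A"
      by (auto intro!: prod.mono_neutral_left simp: in_keys_iff)
    moreover have "?p (\<alpha> + \<beta>) ?A = ?p \<alpha> ?A * ?p \<beta> ?A"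
      by (simp add: lookup_add power_add prod.distrib)
    ultimately show ?case
      by (subst mult_single) (simp only: eval_mpoly_single keys_monom_add mult_ac C.hom_mult)
  qed (simp add: distrib_left eval_mpoly_add)
qed (simp add: distrib_right eval_mpoly_add)

lemma comm_ring_hom_eval_mpoly: "comm_ring_hom (eval_mpoly C \<sigma>)"
  using eval_mpoly_const[of \<sigma> 1] eval_mpoly_const[of \<sigma> 0]
  by unfold_locales (simp_all add: eval_mpoly_add eval_mpoly_mult)

end

section \<open>Linear forms are prime\<close>

text \<open>
  The exponents of polynomials in variables indexed by \<open>nat\<close> are linearly ordered, which makes
  these polynomials an instance of \<open>idom\<close>.  They serve as the target of homomorphisms whose kernels
  are to be recognised as prime.
\<close>

type_synonym 'k npoly = "(nat, 'k) mpoly"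

definition linear_form :: "'v set \<Rightarrow> ('v \<Rightarrow> 'k::field) \<Rightarrow> ('v, 'k) mpoly" where
  "linear_form B a = (\<Sum>b\<in>B. const (a b) * var b)"

lemma linear_form_mpolys: "linear_form B a \<in> mpolys B"
  unfolding linear_form_def by (intro sum_mpolys mult_mpolys) (auto simp: single_mpolys)

lemma lookup_linear_form:
  assumes "finite B" "b \<in> B"
  shows "Poly_Mapping.lookup (linear_form B a) (Poly_Mapping.single b (Suc 0)) = a b"
proof -
  have "Poly_Mapping.single c (Suc 0) = Poly_Mapping.single b (Suc 0) \<longleftrightarrow> c = b" for c
    by (metis lookup_single_eq lookup_single_not_eq nat.distinct(1))
  then show ?thesis using assms
    by (simp add: linear_form_def mult_single lookup_sum lookup_single when_def)
qed

lemma mpolys_embedding: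
  assumes "finite B"
  obtains \<psi> :: "('v, 'k::field) mpoly \<Rightarrow> 'k npoly"
  where "comm_ring_hom \<psi>" "\<And>f. f \<in> mpolys B \<Longrightarrow> \<psi> f = 0 \<Longrightarrow> f = 0"
proof -
  obtain i :: "'v \<Rightarrow> nat" where i: "inj_on i B"
    using finite_imp_inj_to_nat_seg[OF assms] by blast
  define \<psi> :: "('v, 'k) mpoly \<Rightarrow> 'k npoly" where "\<psi> = eval_mpoly const (\<lambda>b. var (i b))"
  define \<psi>' :: "'k npoly \<Rightarrow> ('v, 'k) mpoly" where "\<psi>' = eval_mpoly const (\<lambda>n. var (inv_into B i n))"
  interpret \<psi>: comm_ring_hom \<psi>
    unfolding \<psi>_def by (rule comm_ring_hom_eval_mpoly[OF comm_ring_hom_const])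
  interpret \<psi>': comm_ring_hom \<psi>'
    unfolding \<psi>'_def by (rule comm_ring_hom_eval_mpoly[OF comm_ring_hom_const])
  have "\<psi>' (\<psi> f) = f" if "f \<in> mpolys B" for f
    using that
  proof (induction f rule: mpolys_induct)
    case (const a)
    show ?case by (simp add: \<psi>_def \<psi>'_def eval_mpoly_const[OF comm_ring_hom_const])
  next
    case (var b)
    then show ?case using i
      by (simp only: \<psi>_def \<psi>'_def eval_mpoly_var[OF comm_ring_hom_const] inv_into_f_f)
  qed (simp_all add: \<psi>.hom_add \<psi>'.hom_add \<psi>.hom_mult \<psi>'.hom_mult)
  then have "f = 0" if "f \<in> mpolys B" "\<psi> f = 0" for f
    using that by (metis \<psi>'.hom_zero)
  with \<psi>.comm_ring_hom_axioms show ?thesis by (rule that)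
qed

text \<open>
  The exponents of polynomials in variables indexed by an arbitrary \<open>'v\<close> carry no order, but two
  polynomials involve only finitely many variables, and these can be renamed to natural numbers.
\<close>

lemma mpoly_no_zero_divisors:
  fixes f h :: "('v, 'k::field) mpoly"
  assumes "f * h = 0"
  shows "f = 0 \<or> h = 0"
proof -
  define B where "B = (\<Union>\<alpha>\<in>Poly_Mapping.keys f \<union> Poly_Mapping.keys h. Poly_Mapping.keys \<alpha>)"
  have "finite B" by (simp add: B_def)
  then obtain \<psi> :: "('v, 'k) mpoly \<Rightarrow> 'k npoly" where \<psi>: "comm_ring_hom \<psi>"
    and inj: "\<And>f. f \<in> mpolys B \<Longrightarrow> \<psi> f = 0 \<Longrightarrow> f = 0" by (rule mpolys_embedding) blast
  interpret comm_ring_hom \<psi> by (rule \<psi>)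
  have "\<psi> f * \<psi> h = 0" using assms by (metis hom_mult hom_zero)
  then have "\<psi> f = 0 \<or> \<psi> h = 0" by simp
  moreover have "f \<in> mpolys B" "h \<in> mpolys B" by (auto simp: mpolys_def B_def)
  ultimately show ?thesis using inj by blast
qed

lemma mpoly_prod_nonzero:
  fixes f :: "'i \<Rightarrow> ('v, 'k::field) mpoly"
  assumes "\<And>i. i \<in> I \<Longrightarrow> f i \<noteq> 0" shows "prod f I \<noteq> 0"
  using assms by (induction I rule: infinite_finite_induct) (auto dest: mpoly_no_zero_divisors)

text \<open>
  Solving \<open>l = 0\<close> for one of the variables defines a substitution whose kernel is generated by the
  linear form \<open>l\<close>.  As the target is an integral domain, \<open>l\<close> is prime.
\<close>

lemma linear_form_quotient_embedding:
  fixes a :: "'v \<Rightarrow> 'k::field"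
  assumes B: "finite B" and b0: "b0 \<in> B" "a b0 \<noteq> 0"
  obtains \<psi> :: "('v, 'k) mpoly \<Rightarrow> 'k npoly"
  where "comm_ring_hom \<psi>"
    "\<And>f. f \<in> mpolys B \<Longrightarrow> \<psi> f = 0 \<longleftrightarrow> (\<exists>q\<in>mpolys B. f = linear_form B a * q)"
proof -
  let ?l = "linear_form B a"
  define r :: "('v, 'k) mpoly" where "r = (\<Sum>b\<in>B-{b0}. const (- a b / a b0) * var b)"
  define \<phi> where "\<phi> = eval_mpoly const (\<lambda>b. if b = b0 then r else var b)"
  interpret \<phi>: comm_ring_hom \<phi>
    unfolding \<phi>_def by (rule comm_ring_hom_eval_mpoly[OF comm_ring_hom_const])
  have \<phi>_const: "\<phi> (const c) = const c" for c
    unfolding \<phi>_def by (rule eval_mpoly_const[OF comm_ring_hom_const])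
  have \<phi>_var: "\<phi> (var b) = (if b = b0 then r else var b)" for b
    unfolding \<phi>_def by (rule eval_mpoly_var[OF comm_ring_hom_const])
  have var_B: "var b \<in> mpolys B" if "b \<in> B" for b
    using that by (simp add: single_mpolys)
  have const_B: "const c \<in> mpolys B" for c :: 'k
    by (simp add: single_mpolys)
  have r_B: "r \<in> mpolys B"
    unfolding r_def by (intro sum_mpolys mult_mpolys const_B var_B) auto
  have l_split: "?l = const (a b0) * (var b0 - r)"
  proof -
    have "const (a b0) * const (- a b / a b0) = - (const (a b) :: ('v, 'k) mpoly)" for b
      using b0 by (simp add: mult_single single_uminus)
    then have "const (a b0) * r = - (\<Sum>b\<in>B-{b0}. const (a b) * var b)"
      unfolding r_def by (simp only: sum_distrib_left mult_minus_left sum_negf flip: mult.assoc)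
    moreover have "?l = const (a b0) * var b0 + (\<Sum>b\<in>B-{b0}. const (a b) * var b)"
      unfolding linear_form_def using B b0 by (subst sum.remove[of _ b0]) auto
    ultimately show ?thesis by (simp add: right_diff_distrib)
  qed
  have \<phi>_r: "\<phi> r = r"
  proof -
    have "\<phi> r = (\<Sum>b\<in>B-{b0}. const (- a b / a b0) * \<phi> (var b))"
      unfolding r_def by (simp only: \<phi>.hom_sum \<phi>.hom_mult \<phi>_const)
    also have "\<dots> = r" unfolding r_def by (rule sum.cong) (auto simp: \<phi>_var)
    finally show ?thesis .
  qed
  have \<phi>_l: "\<phi> ?l = 0"
    unfolding l_split by (simp only: \<phi>.hom_mult \<phi>.hom_minus \<phi>_r \<phi>_var) simp
  \<comment> \<open>The substitution changes a polynomial by a multiple of the linear form.\<close>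
  have step: "\<phi> f \<in> mpolys B \<and> (\<exists>q\<in>mpolys B. \<phi> f = f - ?l * q)" if "f \<in> mpolys B" for f
    using that
  proof (induction f rule: mpolys_induct)
    case (const c)
    show ?case using const_B by (auto simp: \<phi>_const intro: bexI[of _ 0])
  next
    case (var b)
    show ?case
    proof (cases "b = b0")
      case True
      have "const (a b0) * const (1 / a b0) = (1 :: ('v, 'k) mpoly)"
        using b0 by (simp add: mult_single)
      moreover have "?l * const (1 / a b0) = (const (a b0) * const (1 / a b0)) * (var b0 - r)"
        unfolding l_split by (simp only: mult_ac)
      ultimately have "?l * const (1 / a b0) = var b0 - r" by (simp only: mult_1_left)
      then have "r = var b0 - ?l * const (1 / a b0)" by simp
      moreover have "\<phi> (var b) = r" by (simp only: \<phi>_var True) simp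
      ultimately show ?thesis using r_B const_B[of "1 / a b0"] True by metis
    next
      case False
      then have "\<phi> (var b) = var b" by (simp only: \<phi>_var) simp
      with var show ?thesis using var_B by (metis diff_zero mult_zero_right zero_mpolys)
    qed
  next
    case (add f h)
    then obtain p q where pq: "p \<in> mpolys B" "q \<in> mpolys B" "\<phi> f = f - ?l * p" "\<phi> h = h - ?l * q" by blast
    have "\<phi> (f + h) = f + h - ?l * (p + q)"
      unfolding \<phi>.hom_add pq(3,4) by (simp only: algebra_simps)
    moreover have "\<phi> (f + h) \<in> mpolys B" "p + q \<in> mpolys B"
      using add pq(1,2) by (simp_all add: add_mpolys \<phi>.hom_add)
    ultimately show ?case by blast
  next
    case (mult f h)
    then obtain p q where pq: "p \<in> mpolys B" "q \<in> mpolys B" "\<phi> f = f - ?l * p" "\<phi> h = h - ?l * q" by blast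
    have "\<phi> (f * h) = f * h - ?l * (p * \<phi> h + \<phi> f * q + ?l * p * q)"
      unfolding \<phi>.hom_mult pq(3,4) by (simp add: algebra_simps)
    moreover have "p * \<phi> h + \<phi> f * q + ?l * p * q \<in> mpolys B" "\<phi> (f * h) \<in> mpolys B"
      using mult pq(1,2) unfolding \<phi>.hom_mult by (auto intro!: add_mpolys mult_mpolys linear_form_mpolys)
    ultimately show ?case by blast
  qed
  obtain e :: "('v, 'k) mpoly \<Rightarrow> 'k npoly" where e: "comm_ring_hom e"
    and inj: "\<And>f. f \<in> mpolys B \<Longrightarrow> e f = 0 \<Longrightarrow> f = 0" by (rule mpolys_embedding[OF B]) blast
  interpret e: comm_ring_hom e by (rule e)
  show ?thesis
  proof (rule that)
    show "comm_ring_hom (\<lambda>f. e (\<phi> f))"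
      by (rule comm_ring_hom_compose[OF e \<phi>.comm_ring_hom_axioms])
    fix f :: "('v, 'k) mpoly" assume f: "f \<in> mpolys B"
    show "e (\<phi> f) = 0 \<longleftrightarrow> (\<exists>q\<in>mpolys B. f = ?l * q)"
    proof
      assume "e (\<phi> f) = 0"
      then have "\<phi> f = 0" using step[OF f] inj by blast
      then show "\<exists>q\<in>mpolys B. f = ?l * q" using step[OF f] by (metis eq_iff_diff_eq_0)
    next
      assume "\<exists>q\<in>mpolys B. f = ?l * q"
      then have "\<phi> f = 0" by (metis \<phi>.hom_mult \<phi>_l mult_zero_left)
      then show "e (\<phi> f) = 0" by (simp only: e.hom_zero)
    qed
  qed
qed

section \<open>The action of a finite linear group on the coordinate ring\<close>

locale linear_group =
  fixes s :: "'k::field \<Rightarrow> 'v::ab_group_add \<Rightarrow> 'v" and B :: "'v set" and G :: "('v \<Rightarrow> 'v) set"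
  assumes V: "finite_dimensional_vector_space s B"
    and subgroup_G: "subgroup G (general_linear s)"
    and finite_G: "finite G"
begin

sublocale V: finite_dimensional_vector_space s B by (rule V)

abbreviation act :: "('v \<Rightarrow> 'v) \<Rightarrow> ('v, 'k) mpoly \<Rightarrow> ('v, 'k) mpoly" where
  "act \<equiv> poly_act s B"

definition subgrp :: "('v \<Rightarrow> 'v) set \<Rightarrow> bool" where
  "subgrp H \<longleftrightarrow> subgroup H (general_linear s) \<and> H \<subseteq> G"

definition Inv :: "('v \<Rightarrow> 'v) set \<Rightarrow> ('v, 'k) mpoly set" where
  "Inv H = {f \<in> mpolys B. \<forall>h\<in>H. act h f = f}"

lemma subgrp_G: "subgrp G"
  by (simp add: subgrp_def subgroup_G)

lemma G_carrier: "g \<in> G \<Longrightarrow> g \<in> carrier (general_linear s)"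
  using subgroup_G by (auto dest: subgroup.subset)

lemma G_linear: "g \<in> G \<Longrightarrow> Vector_Spaces.linear s s g"
  and G_bij: "g \<in> G \<Longrightarrow> bij g"
  using G_carrier by (auto simp: general_linear_def)

lemma inj_left_composition:
  assumes "g \<in> G" shows "inj (\<lambda>h :: 'v \<Rightarrow> 'v. g \<circ> h)"
proof (rule injI, rule ext)
  fix x y :: "'v \<Rightarrow> 'v" and v assume "g \<circ> x = g \<circ> y"
  then have "g (x v) = g (y v)" by (metis comp_apply)
  then show "x v = y v" using G_bij[OF assms] by (auto simp: bij_def inj_eq)
qed

context
  fixes H assumes H: "subgrp H"
begin

lemma subgrp_in_G: "h \<in> H \<Longrightarrow> h \<in> G"
  using H by (auto simp: subgrp_def)

lemma subgrp_finite: "finite H"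
  using H finite_G by (auto simp: subgrp_def intro: finite_subset)

lemma subgrp_id: "id \<in> H"
  using H subgroup.one_closed[of H "general_linear s"] by (simp add: subgrp_def general_linear_def)

lemma subgrp_comp: "g \<in> H \<Longrightarrow> h \<in> H \<Longrightarrow> g \<circ> h \<in> H"
  using H subgroup.m_closed[of H "general_linear s" g h] by (simp add: subgrp_def general_linear_def)

lemma left_translation_bij: "g \<in> H \<Longrightarrow> bij_betw (\<lambda>h. g \<circ> h) H H"
proof -
  assume g: "g \<in> H"
  have "inj_on (\<lambda>h. g \<circ> h) H"
    using inj_left_composition[OF subgrp_in_G[OF g]] by (rule inj_on_subset) simp
  moreover have "(\<lambda>h. g \<circ> h) ` H \<subseteq> H" using g subgrp_comp by auto
  ultimately show ?thesis
    using subgrp_finite by (simp add: bij_betw_def endo_inj_surj)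
qed

lemma subgrp_inverse:
  assumes "g \<in> H" obtains h where "h \<in> H" "g \<circ> h = id"
  using left_translation_bij[OF assms] subgrp_id unfolding bij_betw_def by (metis imageE)

end

lemma subgrp_trivial: "subgrp {id}"
proof -
  interpret subgroup G "general_linear s" by (rule subgroup_G)
  have "inv\<^bsub>general_linear s\<^esub> id = id"
    unfolding m_inv_def by (rule the_equality) (auto simp: general_linear_def V.linear_id)
  then show ?thesis
    using subgrp_id[OF subgrp_G] G_carrier
    by (auto simp: subgrp_def intro!: subgroup.intro) (auto simp: general_linear_def)
qed

lemma act_hom: "comm_ring_hom (act g)"
  by unfold_locales (simp_all add: poly_act_0[OF V] poly_act_one[OF V] poly_act_add[OF V] poly_act_mult[OF V])

lemma act_mpolys: "f \<in> mpolys B \<Longrightarrow> act g f \<in> mpolys B"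
  by (rule poly_act_mpolys[OF V])

lemma act_id: "f \<in> mpolys B \<Longrightarrow> act id f = f"
  by (rule poly_act_id[OF V])

lemma act_comp: "g \<in> G \<Longrightarrow> h \<in> G \<Longrightarrow> act (g \<circ> h) f = act g (act h f)"
  by (rule poly_act_comp[OF V G_carrier G_carrier])

lemma Inv_mpolys: "f \<in> Inv H \<Longrightarrow> f \<in> mpolys B"
  and Inv_act: "f \<in> Inv H \<Longrightarrow> h \<in> H \<Longrightarrow> act h f = f"
  by (auto simp: Inv_def)

lemma Inv_trivial: "Inv {id} = mpolys B"
  by (auto simp: Inv_def act_id)

lemma zero_Inv: "0 \<in> Inv H" and one_Inv: "1 \<in> Inv H"
  and add_Inv: "p \<in> Inv H \<Longrightarrow> q \<in> Inv H \<Longrightarrow> p + q \<in> Inv H"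
  and mult_Inv: "p \<in> Inv H \<Longrightarrow> q \<in> Inv H \<Longrightarrow> p * q \<in> Inv H"
  and uminus_Inv: "p \<in> Inv H \<Longrightarrow> - p \<in> Inv H"
  by (auto simp: Inv_def poly_act_0[OF V] poly_act_one[OF V] poly_act_add[OF V] poly_act_mult[OF V]
      poly_act_uminus[OF V] add_mpolys mult_mpolys uminus_mpolys)

lemma const_Inv: "const a \<in> Inv H"
  by (auto simp: Inv_def poly_act_const[OF V] single_mpolys)

lemma sum_Inv: "(\<And>i. i \<in> I \<Longrightarrow> p i \<in> Inv H) \<Longrightarrow> sum p I \<in> Inv H"
  by (induction I rule: infinite_finite_induct) (auto intro: zero_Inv add_Inv)

lemma prod_Inv: "(\<And>i. i \<in> I \<Longrightarrow> p i \<in> Inv H) \<Longrightarrow> prod p I \<in> Inv H"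
  by (induction I rule: infinite_finite_induct) (auto intro: one_Inv mult_Inv)

lemma sum_act_Inv:
  assumes H: "subgrp H" and f: "f \<in> mpolys B"
  shows "(\<Sum>h\<in>H. act h f) \<in> Inv H"
proof -
  have "act g (\<Sum>h\<in>H. act h f) = (\<Sum>h\<in>H. act h f)" if g: "g \<in> H" for g
  proof -
    have "act g (\<Sum>h\<in>H. act h f) = (\<Sum>h\<in>H. act (g \<circ> h) f)"
      using g subgrp_in_G[OF H] by (simp add: poly_act_sum[OF V] act_comp)
    also have "\<dots> = (\<Sum>h\<in>H. act h f)"
      by (rule sum.reindex_bij_betw[OF left_translation_bij[OF H g]])
    finally show ?thesis .
  qed
  then show ?thesis using f by (auto simp: Inv_def intro: sum_mpolys act_mpolys)
qed

subsection \<open>Displacement of coordinates and hyperplanes\<close>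

lemma inv_linear:
  assumes "Vector_Spaces.linear s s h" "bij h"
  shows "Vector_Spaces.linear s s (inv_into UNIV h)"
proof -
  interpret h: Vector_Spaces.linear s s h by (rule assms)
  have hh: "h (inv_into UNIV h x) = x" "inv_into UNIV h (h x) = x" for x
    using assms(2) by (auto simp: bij_def surj_f_inv_f)
  show ?thesis
    by unfold_locales (metis hh h.add, metis hh h.scale)
qed

lemma representation_eqI:
  assumes "\<And>b. b \<in> B \<Longrightarrow> V.representation B x b = V.representation B y b"
  shows "x = y"
proof -
  have "x = (\<Sum>c\<in>B. s (V.representation B x c) c)" for x
    using V.sum_representation_eq[OF V.independent_Basis _ V.finite_Basis subset_refl]
    by (simp add: V.span_Basis)
  then show ?thesis using assms by (metis (mono_tags, lifting) sum.cong)
qed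

lemma displacement_linear_form:
  assumes "b \<in> B"
  shows "act h (var b) - var b =
    linear_form B (\<lambda>c. V.representation B (inv_into UNIV h c) b - (if c = b then 1 else 0))"
proof -
  have "act h (var b) = (\<Sum>c\<in>B. const (V.representation B (inv_into UNIV h c) b) * var c)"
    using poly_act_var[OF V, of h b] by (simp add: coord_act_def mult_single)
  moreover have "var b = (\<Sum>c\<in>B. const (if c = b then 1 else (0::'k)) * var c)"
  proof -
    have "(\<Sum>c\<in>B. const (if c = b then 1 else (0::'k)) * var c) =
        (\<Sum>c\<in>B. if c = b then var b else (0 :: ('v, 'k) mpoly))"
      by (rule sum.cong) auto
    also have "\<dots> = var b" using assms V.finite_Basis by simp
    finally show ?thesis by (rule sym)
  qed
  ultimately show ?thesis
    by (simp only: linear_form_def single_diff left_diff_distrib sum_subtractf)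
qed

text \<open>
  The action on linear forms is faithful.  The displacement of a coordinate is again a linear form;
  products of such displacements are the multipliers that are cancelled later.
\<close>

lemma moves_coordinate:
  assumes g: "g \<in> G" "g \<noteq> id"
  obtains b a c where "b \<in> B" "act g (var b) - var b = linear_form B a" "c \<in> B" "a c \<noteq> 0"
proof -
  let ?r = "V.representation B"
  interpret g: Vector_Spaces.linear s s g using g G_linear by blast
  have "\<exists>b\<in>B. \<exists>c\<in>B. ?r (inv_into UNIV g c) b \<noteq> (if c = b then 1 else 0)"
  proof (rule ccontr)
    assume "\<not> ?thesis"
    then have "?r (inv_into UNIV g c) b = ?r c b" if "b \<in> B" "c \<in> B" for b c
      using that by (auto simp: V.representation_basis V.independent_Basis)
    then have "inv_into UNIV g c = c" if "c \<in> B" for c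
      using representation_eqI that by blast
    then have gB: "g c = c" if "c \<in> B" for c
      using that G_bij[OF g(1)] by (metis bij_inv_eq_iff)
    have "g x = id x" for x
    proof -
      have x: "x = (\<Sum>c\<in>B. s (?r x c) c)"
        using V.sum_representation_eq[OF V.independent_Basis _ V.finite_Basis subset_refl]
        by (simp add: V.span_Basis)
      have "g (\<Sum>c\<in>B. s (?r x c) c) = (\<Sum>c\<in>B. s (?r x c) c)"
        by (simp add: g.sum g.scale gB)
      then show ?thesis using x by simp
    qed
    then show False using g(2) by blast
  qed
  then obtain b c where bc: "b \<in> B" "c \<in> B" "?r (inv_into UNIV g c) b \<noteq> (if c = b then 1 else 0)"
    by blast
  show ?thesis
    by (rule that[OF bc(1) displacement_linear_form[OF bc(1)] bc(2)]) (use bc(3) in simp)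
qed

text \<open>
  Let \<open>h\<close> act trivially modulo the linear form \<open>l\<close>.  Evaluation at a zero \<open>u\<close> of \<open>l\<close> shows that \<open>h\<^sup>-\<^sup>1 u\<close>
  and \<open>u\<close> have the same coordinates.  Hence \<open>h\<close> fixes the kernel of \<open>l\<close>, which is a hyperplane.
\<close>

lemma fixes_hyperplaneI:
  assumes h: "h \<in> G" and a: "b0 \<in> B" "a b0 \<noteq> 0"
    and cong: "\<And>b. b \<in> B \<Longrightarrow> \<exists>q. act h (var b) - var b = linear_form B a * q"
  shows "fixes_hyperplane s h"
proof -
  let ?r = "V.representation B" and ?h' = "inv_into UNIV h"
  define ev where "ev v = eval_mpoly (\<lambda>x. x) (?r v)" for v
  have id_hom: "comm_ring_hom (\<lambda>x::'k. x)" by unfold_locales auto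
  have ev_hom: "comm_ring_hom (ev v)" for v
    unfolding ev_def by (rule comm_ring_hom_eval_mpoly[OF id_hom])
  have ev_lin: "ev v (linear_form B c) = (\<Sum>b\<in>B. c b * ?r v b)" for v c
  proof -
    interpret comm_ring_hom "ev v" by (rule ev_hom)
    show ?thesis
      by (simp only: linear_form_def hom_sum hom_mult)
        (simp only: ev_def eval_mpoly_const[OF id_hom] eval_mpoly_var[OF id_hom])
  qed
  define lam where "lam v = (\<Sum>b\<in>B. a b * ?r v b)" for v
  have sp: "x \<in> V.span B" for x by (simp add: V.span_Basis)
  have lam_add: "lam (x + y) = lam x + lam y" for x y
    by (simp add: lam_def V.representation_add[OF V.independent_Basis] sp distrib_left sum.distrib)
  have lam_scale: "lam (s c x) = c * lam x" for c x
    by (simp add: lam_def V.representation_scale[OF V.independent_Basis] sp sum_distrib_left mult.left_commute)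
  interpret h': Vector_Spaces.linear s s ?h' by (rule inv_linear[OF G_linear[OF h] G_bij[OF h]])
  have rep: "x = (\<Sum>c\<in>B. s (?r x c) c)" for x
    using V.sum_representation_eq[OF V.independent_Basis sp V.finite_Basis subset_refl] by simp
  have rh: "?r (?h' x) b = (\<Sum>c\<in>B. ?r (?h' c) b * ?r x c)" for x b
  proof -
    have "?r (?h' x) b = ?r (\<Sum>c\<in>B. s (?r x c) (?h' c)) b"
      by (subst rep[of x]) (simp add: h'.sum h'.scale)
    also have "\<dots> = (\<Sum>c\<in>B. ?r (?h' c) b * ?r x c)"
      by (simp add: V.representation_sum[OF V.independent_Basis] V.representation_scale[OF V.independent_Basis] sp mult.commute)
    finally show ?thesis .
  qed
  define U where "U = {v. lam v = 0}"
  have fixed: "h u = u" if "u \<in> U" for u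
  proof -
    interpret comm_ring_hom "ev u" by (rule ev_hom)
    have "?r (?h' u) b = ?r u b" if b: "b \<in> B" for b
    proof -
      obtain q where "act h (var b) - var b = linear_form B a * q" using cong[OF b] by blast
      then have "ev u (act h (var b) - var b) = 0"
        using \<open>u \<in> U\<close> by (simp only: hom_mult ev_lin) (simp add: U_def lam_def)
      then have "(\<Sum>c\<in>B. (?r (?h' c) b - (if c = b then 1 else 0)) * ?r u c) = 0"
        by (simp only: displacement_linear_form[OF b] ev_lin)
      moreover have "(\<Sum>c\<in>B. (if c = b then 1 else 0) * ?r u c) = ?r u b"
        using b V.finite_Basis by (simp add: if_distrib[of "\<lambda>x. x * _"] cong: if_cong)
      ultimately show ?thesis
        by (subst rh) (simp only: left_diff_distrib sum_subtractf right_minus_eq)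
    qed
    then have "?h' u = u" by (rule representation_eqI)
    then show ?thesis using G_bij[OF h] by (metis bij_inv_eq_iff)
  qed
  have U: "V.subspace U"
    using lam_scale[of 0 0] by (auto simp: V.subspace_def U_def lam_add lam_scale)
  have "lam b0 = a b0"
    using a(1) V.finite_Basis
    by (simp add: lam_def V.representation_basis V.independent_Basis if_distrib[of "\<lambda>x. _ * x"] cong: if_cong)
  then have nz: "lam b0 \<noteq> 0" using a(2) by simp
  have spU: "V.span U = U" using U by (simp add: V.span_eq_iff)
  have "x \<in> V.span (insert b0 U)" for x
  proof -
    have "x - s (lam x / lam b0) b0 \<in> U"
      using nz lam_add[of "x - s (lam x / lam b0) b0" "s (lam x / lam b0) b0"]
      by (simp add: U_def lam_scale)
    then show ?thesis by (auto simp: V.span_insert spU)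
  qed
  then have "V.span (insert b0 U) = UNIV" by blast
  then have "V.dim UNIV = V.dim (insert b0 U)" by (metis V.dim_span)
  also have "\<dots> = V.dim U + 1" using nz by (simp add: V.dim_insert spU) (simp add: U_def)
  finally show ?thesis unfolding fixes_hyperplane_def using U fixed by metis
qed

subsection \<open>Separating a subgroup from its complement\<close>

text \<open>
  For \<open>h \<in> G'\<close> consider the product of the factors \<open>g y\<^sub>g - h y\<^sub>g\<close> over \<open>g \<in> G' - H\<close>.  It vanishes for
  \<open>h \<notin> H\<close>, because of the factor with \<open>g = h\<close>, and it equals \<open>D\<close> for \<open>h \<in> H\<close>, because \<open>y\<^sub>g\<close> is
  invariant.  Multiplying out writes it as a sum of terms \<open>u \<cdot> h w\<close> with \<open>w\<close> invariant under \<open>H\<close> and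
  \<open>u\<close> independent of \<open>h\<close>.  Applied under a trace, such a sum isolates the contribution of \<open>H\<close>.
\<close>

lemma separating_functional:
  assumes G': "subgrp G'" and H: "subgrp H" and y: "\<And>g. g \<in> G' - H \<Longrightarrow> y g \<in> Inv H"
  defines "D \<equiv> \<Prod>g\<in>G'-H. act g (y g) - y g"
  obtains I :: "('v \<Rightarrow> 'v) set set" and u w where "finite I"
    "\<And>X. X \<in> I \<Longrightarrow> u X \<in> mpolys B" "\<And>X. X \<in> I \<Longrightarrow> w X \<in> Inv H"
    "\<And>h. h \<in> G' \<Longrightarrow> (\<Sum>X\<in>I. u X * act h (w X)) = (if h \<in> H then D else 0)"
proof -
  let ?L = "G' - H"
  have fin: "finite ?L" using subgrp_finite[OF G'] by simp
  define u where "u X = (\<Prod>g\<in>X. act g (y g))" for X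
  define w where "w X = (\<Prod>g\<in>?L-X. - y g)" for X
  have expand: "(\<Sum>X\<in>Pow ?L. u X * act h (w X)) = (\<Prod>g\<in>?L. act g (y g) - act h (y g))" for h
    using prod_add[OF fin, of "\<lambda>g. act g (y g)" "\<lambda>g. - act h (y g)"]
    by (simp add: u_def w_def poly_act_prod[OF V] poly_act_uminus[OF V])
  show ?thesis
  proof (rule that[of "Pow ?L" u w])
    show "finite (Pow ?L)" using fin by simp
    show "u X \<in> mpolys B" if "X \<in> Pow ?L" for X
      using that unfolding u_def by (auto intro!: prod_mpolys act_mpolys Inv_mpolys[OF y])
    show "w X \<in> Inv H" if "X \<in> Pow ?L" for X
      unfolding w_def by (auto intro!: prod_Inv uminus_Inv y)
    show "(\<Sum>X\<in>Pow ?L. u X * act h (w X)) = (if h \<in> H then D else 0)" if h: "h \<in> G'" for h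
    proof (cases "h \<in> H")
      case True
      then show ?thesis unfolding expand D_def using Inv_act[OF y] by (auto intro!: prod.cong)
    next
      case False
      then show ?thesis unfolding expand using h fin by (auto intro!: prod_zero bexI[of _ h])
    qed
  qed
qed

subsection \<open>Congruences that hold on invariants\<close>

text \<open>
  For a single \<open>x\<close>, the polynomial with the roots \<open>k x\<close>, \<open>k \<in> K\<close>, has invariant coefficients.  So \<open>\<psi>\<close>
  identifies it with its image under \<open>g\<close>, whose roots are the \<open>g k x\<close>.  As \<open>x\<close> is a root of the former
  and \<open>\<psi>\<close> maps to an integral domain, \<open>\<psi> (g k x) = \<psi> x\<close> for some \<open>k\<close>.  To get one \<open>k\<close> for all \<open>x\<close>, also
  over a finite field, the argument is applied to a polynomial in an auxiliary indeterminate that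
  has a potential counterexample for each \<open>k\<close> among its coefficients.
\<close>

lemma congruent_on_invariants:
  fixes \<psi> :: "('v, 'k) mpoly \<Rightarrow> 'r::idom"
  assumes K: "subgrp K" and g: "g \<in> G" and \<psi>: "comm_ring_hom \<psi>"
    and inv: "\<And>y. y \<in> Inv K \<Longrightarrow> \<psi> (act g y) = \<psi> y"
  shows "\<exists>k\<in>K. \<forall>x\<in>mpolys B. \<psi> (act (g \<circ> k) x) = \<psi> x"
proof (rule ccontr)
  assume "\<not> ?thesis"
  then obtain x where x: "\<And>k. k \<in> K \<Longrightarrow> x k \<in> mpolys B" "\<And>k. k \<in> K \<Longrightarrow> \<psi> (act (g \<circ> k) (x k)) \<noteq> \<psi> (x k)"
    by metis
  obtain j :: "('v \<Rightarrow> 'v) \<Rightarrow> nat" where j: "inj_on j K"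
    using finite_imp_inj_to_nat_seg[OF subgrp_finite[OF K]] by blast
  have actX_hom: "comm_ring_hom (map_poly (act h))" for h
  proof -
    interpret act: comm_ring_hom "act h" by (rule act_hom)
    interpret map_poly_comm_ring_hom "act h" ..
    show ?thesis ..
  qed
  interpret \<psi>: comm_ring_hom \<psi> by (rule \<psi>)
  interpret \<psi>X: map_poly_comm_ring_hom \<psi> ..
  \<comment> \<open>Distinct exponents keep the counterexamples apart as coefficients of one polynomial.\<close>
  define z where "z = (\<Sum>k\<in>K. monom (x k) (j k))"
  have coeff_z: "poly.coeff z (j k) = x k" if "k \<in> K" for k
  proof -
    have "poly.coeff z (j k) = (\<Sum>l\<in>K. if l = k then x l else 0)"
      unfolding z_def coeff_sum using j that
      by (intro sum.cong) (auto simp: inj_on_eq_iff)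
    then show ?thesis using that subgrp_finite[OF K] by simp
  qed
  have z_B: "poly.coeff z n \<in> mpolys B" for n
    unfolding z_def coeff_sum using x(1) by (intro sum_mpolys) auto
  define A where "A h = map_poly (act h)" for h
  have A0: "act h 0 = 0" for h by (rule poly_act_0[OF V])
  have A_comp: "A (h \<circ> k) z = A h (A k z)" if "h \<in> G" "k \<in> G" for h k
    unfolding A_def by (rule poly_eqI) (simp add: coeff_map_poly A0 act_comp that)
  \<comment> \<open>The orbit polynomial of \<open>z\<close>; its coefficients are polynomials in the auxiliary indeterminate.\<close>
  define Q where "Q = (\<Prod>k\<in>K. [:- A k z, 1:])"
  have map_Q: "map_poly (A h) Q = (\<Prod>k\<in>K. [:- A (h \<circ> k) z, 1:])" if "h \<in> G" for h
  proof -
    interpret A: comm_ring_hom "A h" unfolding A_def by (rule actX_hom)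
    interpret AX: map_poly_comm_ring_hom "A h" ..
    have "map_poly (A h) Q = (\<Prod>k\<in>K. map_poly (A h) [:- A k z, 1:])"
      unfolding Q_def by (rule AX.hom_prod)
    also have "\<dots> = (\<Prod>k\<in>K. [:- A (h \<circ> k) z, 1:])"
      using that subgrp_in_G[OF K]
      by (intro prod.cong) (simp_all add: A.hom_uminus A_comp)
    finally show ?thesis .
  qed
  have Q_inv: "poly.coeff (poly.coeff Q m) n \<in> Inv K" for m n
  proof -
    have "A k (poly.coeff Q m) = poly.coeff Q m" if k: "k \<in> K" for k
    proof -
      interpret A: comm_ring_hom "A k" unfolding A_def by (rule actX_hom)
      have "map_poly (A k) Q = (\<Prod>l\<in>K. [:- A l z, 1:])"
        unfolding map_Q[OF subgrp_in_G[OF K k]]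
        by (rule prod.reindex_bij_betw[OF left_translation_bij[OF K k]])
      then have "map_poly (A k) Q = Q" by (simp only: Q_def)
      then show ?thesis by (metis A.hom_zero coeff_map_poly)
    qed
    then have "act k (poly.coeff (poly.coeff Q m) n) = poly.coeff (poly.coeff Q m) n" if "k \<in> K" for k
      using that by (metis A0 A_def coeff_map_poly)
    moreover have "poly.coeff (poly.coeff Q m) n \<in> mpolys B"
    proof -
      \<comment> \<open>The polynomials in the auxiliary indeterminate with coefficients in the coordinate ring.\<close>
      define PB :: "('v, 'k) mpoly poly set" where "PB = {p. \<forall>n. poly.coeff p n \<in> mpolys B}"
      have mult_PB: "p * q \<in> PB" if "p \<in> PB" "q \<in> PB" for p q
        using that by (auto simp: PB_def coeff_mult intro!: sum_mpolys mult_mpolys)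
      have add_PB: "p + q \<in> PB" if "p \<in> PB" "q \<in> PB" for p q
        using that by (auto simp: PB_def intro!: add_mpolys)
      have zero_PB: "0 \<in> PB" by (simp add: PB_def)
      have "poly.coeff (\<Prod>k\<in>L. [:- A k z, 1:]) m \<in> PB" if "finite L" for L m
        using that
      proof (induction L arbitrary: m)
        case empty
        show ?case by (cases "m = 0") (auto simp: PB_def coeff_1)
      next
        case (insert k L)
        have "- A k z \<in> PB"
          by (auto simp: PB_def A_def coeff_map_poly A0 intro!: uminus_mpolys act_mpolys z_B)
        then have "- A k z * poly.coeff (\<Prod>k\<in>L. [:- A k z, 1:]) m +
            (case m of 0 \<Rightarrow> 0 | Suc n \<Rightarrow> poly.coeff (\<Prod>k\<in>L. [:- A k z, 1:]) n) \<in> PB"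
          using insert.IH by (intro add_PB mult_PB) (auto simp: zero_PB split: nat.split)
        moreover have "poly.coeff ([:- A k z, 1:] * P) m =
            - A k z * poly.coeff P m + (case m of 0 \<Rightarrow> 0 | Suc n \<Rightarrow> poly.coeff P n)" for P
          by (simp add: coeff_pCons)
        ultimately show ?case by (simp only: prod.insert[OF insert.hyps])
      qed
      then show ?thesis using subgrp_finite[OF K] by (auto simp: Q_def PB_def)
    qed
    ultimately show ?thesis by (auto simp: Inv_def)
  qed
  have "map_poly (map_poly \<psi>) (map_poly (A g) Q) = map_poly (map_poly \<psi>) Q"
    by (intro poly_eqI) (simp add: coeff_map_poly A_def A0 inv[OF Q_inv])
  then have "map_poly \<psi> (poly (map_poly (A g) Q) z) = map_poly \<psi> (poly Q z)"
    by (simp only: \<psi>X.poly_map_poly[symmetric])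
  moreover have "poly Q z = 0"
  proof -
    have "A id z = z" by (rule poly_eqI) (simp add: A_def coeff_map_poly A0 act_id z_B)
    then show ?thesis unfolding Q_def poly_prod
      using subgrp_id[OF K] subgrp_finite[OF K] by (intro prod_zero bexI[of _ id]) auto
  qed
  ultimately have "map_poly \<psi> (\<Prod>k\<in>K. z - A (g \<circ> k) z) = 0"
    unfolding map_Q[OF g] poly_prod by simp
  then have "(\<Prod>k\<in>K. map_poly \<psi> (z - A (g \<circ> k) z)) = 0"
    by (simp only: \<psi>X.hom_prod)
  then obtain k where k: "k \<in> K" "map_poly \<psi> (z - A (g \<circ> k) z) = 0"
    using subgrp_finite[OF K] by auto
  then have "poly.coeff (map_poly \<psi> (z - A (g \<circ> k) z)) (j k) = 0" by simp
  then have "\<psi> (x k) = \<psi> (act (g \<circ> k) (x k))"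
    by (simp add: coeff_map_poly A_def A0 coeff_z[OF k(1)] \<psi>.hom_minus)
  with x(2)[OF k(1)] show False by simp
qed

end

section \<open>Modules of covariants\<close>

lemma (in linear_group) diff_Inv: "p \<in> Inv H \<Longrightarrow> q \<in> Inv H \<Longrightarrow> p - q \<in> Inv H"
  using add_Inv[OF _ uminus_Inv, of p H q] by simp

locale covariant_data = linear_group s B G
  for s :: "'k::field \<Rightarrow> 'v::ab_group_add \<Rightarrow> 'v" and B :: "'v set" and G :: "('v \<Rightarrow> 'v) set" +
  fixes sM :: "'k \<Rightarrow> 'm::ab_group_add \<Rightarrow> 'm" and \<rho> :: "('v \<Rightarrow> 'v) \<Rightarrow> 'm \<Rightarrow> 'm"
  assumes M: "vector_space sM"
    and \<rho>: "\<rho> \<in> hom (general_linear s\<lparr>carrier := G\<rparr>) (general_linear sM)"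
begin

sublocale M: vector_space sM by (rule M)

abbreviation tact :: "('v \<Rightarrow> 'v) \<Rightarrow> ('v, 'm) mpoly \<Rightarrow> ('v, 'm) mpoly" where
  "tact \<equiv> tensor_act s B sM \<rho>"

abbreviation smul :: "('v, 'k) mpoly \<Rightarrow> ('v, 'm) mpoly \<Rightarrow> ('v, 'm) mpoly" (infixr "\<star>" 75) where
  "f \<star> t \<equiv> poly_smult sM f t"

sublocale T: Modules.module "poly_smult sM"
  by unfold_locales
    (simp_all add: poly_smult_add_left[OF M] poly_smult_add_right[OF M] poly_smult_mult[OF M] poly_smult_one[OF M])

definition Cov :: "('v \<Rightarrow> 'v) set \<Rightarrow> ('v, 'm) mpoly set" where
  "Cov H = {t \<in> mpolys B. \<forall>h\<in>H. tact h t = t}"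

text \<open>
  A coordinate function of \<open>M\<close> that does not vanish on some coefficient of \<open>t\<close> turns \<open>f t = 0\<close> into an
  equation between polynomials over the field.
\<close>

lemma smul_eq_0:
  assumes "f \<star> t = 0" "f \<noteq> 0" shows "t = 0"
proof (rule ccontr)
  assume "t \<noteq> 0"
  then have "Poly_Mapping.keys t \<noteq> {}" by simp
  then obtain \<alpha> where "\<alpha> \<in> Poly_Mapping.keys t" by blast
  then have \<alpha>: "Poly_Mapping.lookup t \<alpha> \<noteq> 0" by (simp add: in_keys_iff)
  obtain BM where BM0: "M.independent BM" "UNIV \<subseteq> M.span BM"
    by (rule M.maximal_independent_subset[of UNIV])
  then have BM: "M.independent BM" "M.span BM = UNIV" by auto
  let ?m = "Poly_Mapping.lookup t \<alpha>"
  obtain b where b: "M.representation BM ?m b \<noteq> 0"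
  proof -
    have "(\<Sum>b | M.representation BM ?m b \<noteq> 0. sM (M.representation BM ?m b) b) = ?m"
      by (rule M.sum_nonzero_representation_eq) (use BM in auto)
    then have "{b. M.representation BM ?m b \<noteq> 0} \<noteq> {}" using \<alpha> by (metis sum.empty)
    then show ?thesis using that by blast
  qed
  define \<mu> where "\<mu> m = M.representation BM m b" for m
  have \<mu>_add: "\<mu> (x + y) = \<mu> x + \<mu> y" for x y
    unfolding \<mu>_def using M.representation_add[OF BM(1)] BM(2) by auto
  have \<mu>_scale: "\<mu> (sM c x) = c * \<mu> x" for c x
    unfolding \<mu>_def using M.representation_scale[OF BM(1)] BM(2) by auto
  have \<mu>_0: "\<mu> 0 = 0" using \<mu>_scale[of 0 0] by simp
  define \<kappa> :: "('v, 'm) mpoly \<Rightarrow> ('v, 'k) mpoly" where "\<kappa> = Poly_Mapping.map \<mu>"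
  have lookup_\<kappa>: "Poly_Mapping.lookup (\<kappa> u) \<beta> = \<mu> (Poly_Mapping.lookup u \<beta>)" for u \<beta>
    by (simp add: \<kappa>_def Poly_Mapping.map.rep_eq when_def \<mu>_0)
  have \<kappa>_add: "\<kappa> (u + w) = \<kappa> u + \<kappa> w" for u w
    by (rule poly_mapping_eqI) (simp add: lookup_\<kappa> lookup_add \<mu>_add)
  have \<kappa>_tensor: "\<kappa> (tensor sM p m) = p * const (\<mu> m)" for p m
  proof (rule poly_mapping_eqI)
    fix \<beta>
    have "Poly_Mapping.lookup (const (\<mu> m) * p) \<beta> = \<mu> m * Poly_Mapping.lookup p \<beta>"
      by (simp add: Poly_Mapping.map.rep_eq when_def flip: mult_map_scale_conv_mult)
    then show "Poly_Mapping.lookup (\<kappa> (tensor sM p m)) \<beta> = Poly_Mapping.lookup (p * const (\<mu> m)) \<beta>"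
      by (simp add: lookup_\<kappa> lookup_tensor[OF M] \<mu>_scale mult.commute)
  qed
  have "\<kappa> (f \<star> u) = f * \<kappa> u" for u
  proof (induction u rule: poly_mapping_add_induct)
    case (single \<beta> m)
    have "\<kappa> (Poly_Mapping.single \<beta> m) = Poly_Mapping.single \<beta> 1 * const (\<mu> m)"
      using \<kappa>_tensor[of "Poly_Mapping.single \<beta> 1" m] by (simp add: tensor_single[OF M])
    then show ?case by (simp add: poly_smult_single[OF M] \<kappa>_tensor mult.assoc)
  qed (simp add: T.scale_right_distrib \<kappa>_add distrib_left)
  then have "f * \<kappa> t = \<kappa> 0" using assms(1) by metis
  also have "\<kappa> 0 = 0" by (rule poly_mapping_eqI) (simp add: lookup_\<kappa> \<mu>_0)
  finally have "\<kappa> t = 0" using mpoly_no_zero_divisors assms(2) by blast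
  then have "\<mu> ?m = 0" using lookup_\<kappa>[of t \<alpha>] by simp
  then show False using b by (simp add: \<mu>_def)
qed

lemma tact_add: "g \<in> G \<Longrightarrow> tact g (t + u) = tact g t + tact g u"
  by (rule tensor_act_add[OF V M \<rho>])

lemma tact_0: "tact g 0 = 0"
  by (simp add: tensor_act_def)

lemma tact_smul: "g \<in> G \<Longrightarrow> tact g (f \<star> t) = act g f \<star> tact g t"
  by (rule tensor_act_smult[OF V M \<rho>])

lemma tact_sum: "g \<in> G \<Longrightarrow> tact g (sum t I) = (\<Sum>i\<in>I. tact g (t i))"
  by (induction I rule: infinite_finite_induct) (simp_all add: tact_0 tact_add)

lemma tact_comp: "g \<in> G \<Longrightarrow> h \<in> G \<Longrightarrow> tact (g \<circ> h) t = tact g (tact h t)"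
  using subgrp_comp[OF subgrp_G] subgroup.subset[OF subgroup_G]
  by (intro tensor_act_comp[OF V M \<rho>]) auto

lemma tact_mpolys: "t \<in> mpolys B \<Longrightarrow> tact g t \<in> mpolys B"
  unfolding tensor_act_def
  by (intro sum_mpolys tensor_mpolys[OF M] act_mpolys) (auto simp: single_mpolys mpolys_def)

lemma tact_id:
  assumes "t \<in> mpolys B" shows "tact id t = t"
proof -
  have "\<rho> id = id"
  proof -
    have id: "id \<in> G" by (rule subgrp_id[OF subgrp_G])
    then have bij: "bij (\<rho> id)" using \<rho> by (auto simp: hom_def general_linear_def)
    have "\<forall>x\<in>G. \<forall>y\<in>G. \<rho> (x \<circ> y) = \<rho> x \<circ> \<rho> y" using \<rho> by (simp add: hom_def general_linear_def)
    then have "\<rho> (id \<circ> id) = \<rho> id \<circ> \<rho> id" using id by blast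
    then have "\<rho> id (\<rho> id x) = \<rho> id x" for x by (metis comp_apply id_comp)
    then have "\<rho> id x = x" for x using bij by (metis bij_def injD)
    then show ?thesis by auto
  qed
  moreover have "act id (Poly_Mapping.single \<alpha> 1) = Poly_Mapping.single \<alpha> 1"
    if "\<alpha> \<in> Poly_Mapping.keys t" for \<alpha>
    using that assms by (intro act_id) (auto simp: single_mpolys mpolys_def)
  ultimately have "tact id t =
      (\<Sum>\<alpha>\<in>Poly_Mapping.keys t. tensor sM (Poly_Mapping.single \<alpha> 1) (Poly_Mapping.lookup t \<alpha>))"
    unfolding tensor_act_def by (intro sum.cong) auto
  then show ?thesis by (simp flip: tensor_expansion[OF M])
qed

lemma Cov_mpolys: "t \<in> Cov H \<Longrightarrow> t \<in> mpolys B"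
  and Cov_tact: "t \<in> Cov H \<Longrightarrow> h \<in> H \<Longrightarrow> tact h t = t"
  and Cov_mono: "H \<subseteq> H' \<Longrightarrow> Cov H' \<subseteq> Cov H"
  by (auto simp: Cov_def)

lemma Cov_trivial: "Cov {id} = mpolys B"
  by (auto simp: Cov_def tact_id)

context
  fixes H assumes H: "subgrp H"
begin

lemma smul_Cov: "f \<in> Inv H \<Longrightarrow> t \<in> Cov H \<Longrightarrow> f \<star> t \<in> Cov H"
  by (auto simp: Cov_def Inv_def poly_smult_mpolys[OF M] tact_smul subgrp_in_G[OF H])

end

subsection \<open>Relative traces\<close>

text \<open>
  A sum over all of \<open>G'\<close> would count every coset \<open>card H\<close> times, and this number can be zero in the
  field.  On covariants of \<open>H\<close> all elements of a coset act alike, so that a representative of each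
  coset suffices and its choice is irrelevant.
\<close>

definition cosets :: "('v \<Rightarrow> 'v) set \<Rightarrow> ('v \<Rightarrow> 'v) set \<Rightarrow> ('v \<Rightarrow> 'v) set set" where
  "cosets G' H = (\<lambda>g. (\<lambda>h. g \<circ> h) ` H) ` G'"

definition rep :: "('v \<Rightarrow> 'v) set \<Rightarrow> 'v \<Rightarrow> 'v" where
  "rep C = (SOME g. g \<in> C)"

definition rel_trace :: "('v \<Rightarrow> 'v) set \<Rightarrow> ('v \<Rightarrow> 'v) set \<Rightarrow> ('v, 'm) mpoly \<Rightarrow> ('v, 'm) mpoly" where
  "rel_trace G' H t = (\<Sum>C\<in>cosets G' H. tact (rep C) t)"

context
  fixes G' H assumes G': "subgrp G'" and H: "subgrp H" and HG': "H \<subseteq> G'"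
begin

lemma rep_coset:
  assumes "g \<in> G'"
  obtains h where "h \<in> H" "rep ((\<lambda>h. g \<circ> h) ` H) = g \<circ> h"
proof -
  have "rep ((\<lambda>h. g \<circ> h) ` H) \<in> (\<lambda>h. g \<circ> h) ` H"
    unfolding rep_def using subgrp_id[OF H] by (metis imageI someI)
  then show ?thesis using that by blast
qed

lemma rep_in:
  assumes "C \<in> cosets G' H" shows "rep C \<in> G'"
proof -
  obtain g where g: "g \<in> G'" "C = (\<lambda>h. g \<circ> h) ` H" using assms by (auto simp: cosets_def)
  obtain h where "h \<in> H" "rep C = g \<circ> h" using rep_coset[OF g(1)] g(2) by blast
  then show ?thesis using subgrp_comp[OF G' g(1)] HG' by auto
qed

lemma tact_rep:
  assumes g: "g \<in> G'" and t: "t \<in> Cov H"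
  shows "tact (rep ((\<lambda>h. g \<circ> h) ` H)) t = tact g t"
proof -
  obtain h where h: "h \<in> H" "rep ((\<lambda>h. g \<circ> h) ` H) = g \<circ> h" using g by (rule rep_coset)
  then show ?thesis
    using g t by (simp add: tact_comp subgrp_in_G[OF G'] subgrp_in_G[OF H] Cov_tact)
qed

lemma rep_in_subgroup_iff:
  assumes "C \<in> cosets G' H" shows "rep C \<in> H \<longleftrightarrow> C = H"
proof -
  obtain g where g: "g \<in> G'" "C = (\<lambda>h. g \<circ> h) ` H" using assms by (auto simp: cosets_def)
  obtain h where h: "h \<in> H" "rep C = g \<circ> h" using rep_coset[OF g(1)] g(2) by blast
  have img: "(\<lambda>x. k \<circ> x) ` H = H" if "k \<in> H" for k
    using left_translation_bij[OF H that] by (simp add: bij_betw_def)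
  have "C = (\<lambda>x. (g \<circ> h) \<circ> x) ` H"
  proof -
    have "(\<lambda>x. (g \<circ> h) \<circ> x) ` H = (\<lambda>x. g \<circ> x) ` (\<lambda>x. h \<circ> x) ` H"
      by (simp add: image_image comp_assoc)
    then show ?thesis using img[OF h(1)] g(2) by simp
  qed
  then have "C = H" if "rep C \<in> H" using img[OF that] h(2) by simp
  moreover have "rep H \<in> H" unfolding rep_def using subgrp_id[OF H] by (metis someI)
  ultimately show ?thesis by auto
qed

lemma subgroup_in_cosets: "H \<in> cosets G' H"
proof -
  have "(\<lambda>h. id \<circ> h) ` H = H" by simp
  then show ?thesis unfolding cosets_def using subgrp_id[OF G'] by (metis imageI)
qed

lemma finite_cosets: "finite (cosets G' H)"
  by (simp add: cosets_def subgrp_finite[OF G'])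

lemma rel_trace_Cov:
  assumes t: "t \<in> Cov H" shows "rel_trace G' H t \<in> Cov G'"
proof -
  have "tact g (rel_trace G' H t) = rel_trace G' H t" if g: "g \<in> G'" for g
  proof -
    let ?L = "\<lambda>C. (\<lambda>h. g \<circ> h) ` C"
    have "inj_on ?L (cosets G' H)"
    proof (rule inj_onI)
      fix C C' :: "('v \<Rightarrow> 'v) set" assume "?L C = ?L C'"
      then show "C = C'"
        using inj_left_composition[OF subgrp_in_G[OF G' g]] by (simp add: inj_image_eq_iff)
    qed
    moreover have L: "?L ((\<lambda>h. x \<circ> h) ` H) = (\<lambda>h. (g \<circ> x) \<circ> h) ` H" for x
      by (simp add: image_image comp_assoc)
    then have "?L ` cosets G' H \<subseteq> cosets G' H"
      unfolding cosets_def using subgrp_comp[OF G' g] by auto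
    ultimately have bij: "bij_betw ?L (cosets G' H) (cosets G' H)"
      using finite_cosets by (simp add: bij_betw_def endo_inj_surj)
    have "tact g (rel_trace G' H t) = (\<Sum>C\<in>cosets G' H. tact g (tact (rep C) t))"
      unfolding rel_trace_def by (rule tact_sum[OF subgrp_in_G[OF G' g]])
    also have "\<dots> = (\<Sum>C\<in>cosets G' H. tact (rep (?L C)) t)"
    proof (rule sum.cong)
      fix C assume "C \<in> cosets G' H"
      then obtain x where x: "x \<in> G'" "C = (\<lambda>h. x \<circ> h) ` H" by (auto simp: cosets_def)
      have "tact (rep (?L C)) t = tact (g \<circ> x) t"
        unfolding x(2) L by (rule tact_rep[OF subgrp_comp[OF G' g x(1)] t])
      also have "\<dots> = tact g (tact (rep C) t)"
        using x t g by (simp add: tact_comp subgrp_in_G[OF G'] tact_rep)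
      finally show "tact g (tact (rep C) t) = tact (rep (?L C)) t" by (rule sym)
    qed simp
    also have "\<dots> = rel_trace G' H t"
      unfolding rel_trace_def by (rule sum.reindex_bij_betw[OF bij])
    finally show ?thesis .
  qed
  then show ?thesis using Cov_mpolys[OF t]
    by (auto simp: Cov_def rel_trace_def intro: sum_mpolys tact_mpolys)
qed

end

subsection \<open>Spans and independence\<close>

text \<open>
  Span and independence refer to elements of the whole of \<open>k[V] \<otimes> M\<close> and to an arbitrary set \<open>R\<close> of
  coefficients, so that the same set of covariants can be studied over several invariant rings.
\<close>

definition rspan :: "('v, 'k) mpoly set \<Rightarrow> ('v, 'm) mpoly set \<Rightarrow> ('v, 'm) mpoly set" where
  "rspan R E = {t. \<exists>A c. finite A \<and> A \<subseteq> E \<and> c \<in> A \<rightarrow> R \<and> t = (\<Sum>a\<in>A. c a \<star> a)}"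

definition indep :: "('v, 'k) mpoly set \<Rightarrow> ('v, 'm) mpoly set \<Rightarrow> bool" where
  "indep R E \<longleftrightarrow> (\<forall>A c. finite A \<and> A \<subseteq> E \<and> c \<in> A \<rightarrow> R \<and> (\<Sum>a\<in>A. c a \<star> a) = 0 \<longrightarrow> (\<forall>a\<in>A. c a = 0))"

lemma rspan_superset:
  assumes "finite A" "A \<subseteq> A'" "finite A'" "c \<in> A \<rightarrow> Inv H" "t = (\<Sum>a\<in>A. c a \<star> a)"
  obtains c' where "c' \<in> A' \<rightarrow> Inv H" "t = (\<Sum>a\<in>A'. c' a \<star> a)"
proof -
  define c' where "c' a = (if a \<in> A then c a else 0)" for a
  have "(\<Sum>a\<in>A. c a \<star> a) = (\<Sum>a\<in>A'. c' a \<star> a)"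
    using assms by (intro sum.mono_neutral_cong_left) (auto simp: c'_def)
  moreover have "c' \<in> A' \<rightarrow> Inv H" using assms(4) by (auto simp: c'_def Pi_iff zero_Inv)
  ultimately show ?thesis by (intro that[of c']) (simp_all add: assms(5))
qed

lemma rspan_common:
  assumes "t \<in> rspan (Inv H) E" "u \<in> rspan (Inv H) E"
  obtains A c d where "finite A" "A \<subseteq> E" "c \<in> A \<rightarrow> Inv H" "d \<in> A \<rightarrow> Inv H"
    "t = (\<Sum>a\<in>A. c a \<star> a)" "u = (\<Sum>a\<in>A. d a \<star> a)"
proof -
  obtain A1 c1 where 1: "finite A1" "A1 \<subseteq> E" "c1 \<in> A1 \<rightarrow> Inv H" "t = (\<Sum>a\<in>A1. c1 a \<star> a)"
    using assms(1) by (auto simp: rspan_def)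
  obtain A2 c2 where 2: "finite A2" "A2 \<subseteq> E" "c2 \<in> A2 \<rightarrow> Inv H" "u = (\<Sum>a\<in>A2. c2 a \<star> a)"
    using assms(2) by (auto simp: rspan_def)
  obtain c where c: "c \<in> A1 \<union> A2 \<rightarrow> Inv H" "t = (\<Sum>a\<in>A1\<union>A2. c a \<star> a)"
    by (rule rspan_superset[of A1 "A1 \<union> A2" c1 H t]) (use 1 2 in auto)
  obtain d where d: "d \<in> A1 \<union> A2 \<rightarrow> Inv H" "u = (\<Sum>a\<in>A1\<union>A2. d a \<star> a)"
    by (rule rspan_superset[of A2 "A1 \<union> A2" c2 H u]) (use 1 2 in auto)
  show ?thesis using that[of "A1 \<union> A2" c d] 1 2 c d by auto
qed

lemma rspan_zero: "0 \<in> rspan (Inv H) E"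
  unfolding rspan_def by (intro CollectI exI[of _ "{}"]) auto

lemma rspan_base: "e \<in> E \<Longrightarrow> e \<in> rspan (Inv H) E"
  unfolding rspan_def using one_Inv by (intro CollectI exI[of _ "{e}"] exI[of _ "\<lambda>_. 1"]) auto

lemma rspan_add:
  assumes "t \<in> rspan (Inv H) E" "u \<in> rspan (Inv H) E" shows "t + u \<in> rspan (Inv H) E"
proof -
  obtain A c d where *: "finite A" "A \<subseteq> E" "c \<in> A \<rightarrow> Inv H" "d \<in> A \<rightarrow> Inv H"
    "t = (\<Sum>a\<in>A. c a \<star> a)" "u = (\<Sum>a\<in>A. d a \<star> a)" by (rule rspan_common[OF assms])
  then have "t + u = (\<Sum>a\<in>A. (c a + d a) \<star> a)" by (simp add: T.scale_left_distrib sum.distrib)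
  then show ?thesis using *
    unfolding rspan_def by (intro CollectI exI[of _ A] exI[of _ "\<lambda>a. c a + d a"]) (auto simp: Pi_iff add_Inv)
qed

lemma rspan_smul:
  assumes "f \<in> Inv H" "t \<in> rspan (Inv H) E" shows "f \<star> t \<in> rspan (Inv H) E"
proof -
  obtain A c where *: "finite A" "A \<subseteq> E" "c \<in> A \<rightarrow> Inv H" "t = (\<Sum>a\<in>A. c a \<star> a)"
    using assms(2) by (auto simp: rspan_def)
  then have "f \<star> t = (\<Sum>a\<in>A. (f * c a) \<star> a)" by (simp add: T.scale_sum_right)
  then show ?thesis using * assms(1)
    unfolding rspan_def by (intro CollectI exI[of _ A] exI[of _ "\<lambda>a. f * c a"]) (auto simp: Pi_iff mult_Inv)
qed

lemma rspan_sum: "(\<And>i. i \<in> I \<Longrightarrow> t i \<in> rspan (Inv H) E) \<Longrightarrow> sum t I \<in> rspan (Inv H) E"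
  by (induction I rule: infinite_finite_induct) (auto intro: rspan_zero rspan_add)

lemma rspan_mono: "R \<subseteq> R' \<Longrightarrow> rspan R E \<subseteq> rspan R' E"
proof
  fix t assume R: "R \<subseteq> R'" and "t \<in> rspan R E"
  then obtain A c where *: "finite A" "A \<subseteq> E" "c \<in> A \<rightarrow> R" "t = (\<Sum>a\<in>A. c a \<star> a)"
    by (auto simp: rspan_def)
  moreover have "c \<in> A \<rightarrow> R'" using *(3) R by auto
  ultimately show "t \<in> rspan R' E" unfolding rspan_def by auto
qed

lemma rspan_idem: "E \<subseteq> rspan (Inv H) E' \<Longrightarrow> rspan (Inv H) E \<subseteq> rspan (Inv H) E'"
proof
  fix t assume E: "E \<subseteq> rspan (Inv H) E'" and "t \<in> rspan (Inv H) E"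
  then obtain A c where *: "A \<subseteq> E" "c \<in> A \<rightarrow> Inv H" "t = (\<Sum>a\<in>A. c a \<star> a)"
    by (auto simp: rspan_def)
  then show "t \<in> rspan (Inv H) E'" using E by (auto intro!: rspan_sum rspan_smul)
qed

lemma indepD:
  assumes "indep R E" "finite A" "A \<subseteq> E" "c \<in> A \<rightarrow> R" "(\<Sum>a\<in>A. c a \<star> a) = 0" "a \<in> A"
  shows "c a = 0"
  using assms(1)[unfolded indep_def, rule_format, of A c a] assms(2-) by simp

lemma indep_mono: "R \<subseteq> R' \<Longrightarrow> indep R' E \<Longrightarrow> indep R E"
  unfolding indep_def[of R] by (intro allI impI ballI, elim conjE, erule (1) indepD) (auto simp: Pi_iff)

lemma indep_eq:
  assumes "indep (Inv H) E" "finite A" "A \<subseteq> E" "c \<in> A \<rightarrow> Inv H" "d \<in> A \<rightarrow> Inv H"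
    "(\<Sum>a\<in>A. c a \<star> a) = (\<Sum>a\<in>A. d a \<star> a)" "a \<in> A"
  shows "c a = d a"
proof -
  have "(\<Sum>a\<in>A. (c a - d a) \<star> a) = 0"
    using assms(6) by (simp add: T.scale_left_diff_distrib sum_subtractf)
  then have "c a - d a = 0"
    using assms(4,5) by (intro indepD[OF assms(1-3) _ _ assms(7)]) (auto simp: Pi_iff diff_Inv)
  then show ?thesis by simp
qed

subsection \<open>Changing the ring of coefficients\<close>

lemma diff_mpolys: "p \<in> mpolys B \<Longrightarrow> q \<in> mpolys B \<Longrightarrow> p - q \<in> mpolys B"
  for p :: "('v, 'k) mpoly"
  using add_mpolys[of p B "- q"] by (simp add: uminus_mpolys)

lemma moving_coordinates:
  obtains y where "\<And>g. g \<in> G - {id} \<Longrightarrow> y g \<in> mpolys B"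
    "\<And>g. g \<in> G - {id} \<Longrightarrow> \<exists>a. act g (y g) - y g = linear_form B a \<and> (\<exists>c\<in>B. a c \<noteq> 0)"
proof -
  have "\<exists>b. b \<in> B \<and> (\<exists>a. act g (var b) - var b = linear_form B a \<and> (\<exists>c\<in>B. a c \<noteq> 0))"
    if "g \<in> G - {id}" for g
    using that by (auto elim!: moves_coordinate)
  then obtain b where b: "\<And>g. g \<in> G - {id} \<Longrightarrow> b g \<in> B"
    "\<And>g. g \<in> G - {id} \<Longrightarrow> \<exists>a. act g (var (b g)) - var (b g) = linear_form B a \<and> (\<exists>c\<in>B. a c \<noteq> 0)"
    by metis
  show ?thesis
    by (rule that[of "\<lambda>g. var (b g)"]) (use b in \<open>auto simp: single_mpolys\<close>)
qed

lemma linear_form_nonzero: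
  assumes "c \<in> B" "a c \<noteq> 0" shows "linear_form B a \<noteq> 0"
  using assms lookup_linear_form[OF V.finite_Basis assms(1), of a] by auto

text \<open>
  Multiply a relation over \<open>k[V]\<close> by \<open>w\<close> and sum its images under \<open>H\<close>: as the elements of \<open>E\<close> are fixed,
  this is a relation whose coefficients are the traces of \<open>w c\<^sub>a\<close>, and these vanish.  The separating
  functional of the trivial subgroup recovers from them the product of \<open>c\<^sub>a\<close> with a nonzero polynomial.
\<close>

lemma indep_extends:
  assumes H: "subgrp H" and E: "E \<subseteq> Cov H" and ind: "indep (Inv H) E"
  shows "indep (mpolys B) E"
  unfolding indep_def
proof (intro allI impI ballI, elim conjE)
  fix A c a assume A: "finite A" "A \<subseteq> E" "c \<in> A \<rightarrow> mpolys B" "(\<Sum>a\<in>A. c a \<star> a) = 0" and a: "a \<in> A"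
  obtain y where y: "\<And>g. g \<in> G - {id} \<Longrightarrow> y g \<in> mpolys B"
    "\<And>g. g \<in> G - {id} \<Longrightarrow> \<exists>a. act g (y g) - y g = linear_form B a \<and> (\<exists>c\<in>B. a c \<noteq> 0)"
    using moving_coordinates by blast
  define D where "D = (\<Prod>g\<in>H-{id}. act g (y g) - y g)"
  have HG: "g \<in> H - {id} \<Longrightarrow> g \<in> G - {id}" for g using subgrp_in_G[OF H] by blast
  have D: "D \<noteq> 0"
    unfolding D_def
  proof (rule mpoly_prod_nonzero)
    fix g assume "g \<in> H - {id}"
    then show "act g (y g) - y g \<noteq> 0" using y(2)[OF HG] linear_form_nonzero by metis
  qed
  obtain I :: "('v \<Rightarrow> 'v) set set" and u w where
    I: "finite I" "\<And>X. X \<in> I \<Longrightarrow> u X \<in> mpolys B" "\<And>X. X \<in> I \<Longrightarrow> w X \<in> Inv {id}"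
    and sep: "\<And>h. h \<in> H \<Longrightarrow> (\<Sum>X\<in>I. u X * act h (w X)) = (if h \<in> {id} then D else 0)"
    unfolding D_def by (rule separating_functional[where y = y, OF H subgrp_trivial y(1)[OF HG, folded Inv_trivial]], assumption) (rule that[unfolded D_def])
  have trace_0: "(\<Sum>h\<in>H. act h (w X * c a)) = 0" if X: "X \<in> I" for X
  proof (rule indepD[OF ind A(1,2) _ _ a])
    show "(\<lambda>a. \<Sum>h\<in>H. act h (w X * c a)) \<in> A \<rightarrow> Inv H"
    proof (rule Pi_I)
      fix e assume "e \<in> A"
      then have "w X * c e \<in> mpolys B"
        using A(3) I(3)[OF X] unfolding Inv_trivial by (blast intro: mult_mpolys)
      then show "(\<Sum>h\<in>H. act h (w X * c e)) \<in> Inv H" by (rule sum_act_Inv[OF H])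
    qed
    have "(\<Sum>a\<in>A. (\<Sum>h\<in>H. act h (w X * c a)) \<star> a) = (\<Sum>a\<in>A. \<Sum>h\<in>H. tact h ((w X * c a) \<star> a))"
      using A(2) E subgrp_in_G[OF H]
      by (intro sum.cong refl) (auto simp: T.scale_sum_left tact_smul Cov_tact intro!: sum.cong)
    also have "\<dots> = (\<Sum>h\<in>H. tact h (\<Sum>a\<in>A. (w X * c a) \<star> a))"
      using subgrp_in_G[OF H] by (subst sum.swap) (simp add: tact_sum)
    also have "\<dots> = (\<Sum>h\<in>H. tact h (w X \<star> (\<Sum>a\<in>A. c a \<star> a)))"
      by (simp add: T.scale_sum_right)
    also have "\<dots> = 0" using A(4) by (simp add: tact_0)
    finally show "(\<Sum>a\<in>A. (\<Sum>h\<in>H. act h (w X * c a)) \<star> a) = 0" .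
  qed
  have ca: "c a \<in> mpolys B" using A(3) a by auto
  have "D * c a = (\<Sum>h\<in>H. (if h \<in> {id} then D else 0) * act h (c a))"
    using subgrp_finite[OF H] subgrp_id[OF H] act_id[OF ca]
    by (subst sum.remove[of H id]) auto
  also have "\<dots> = (\<Sum>h\<in>H. (\<Sum>X\<in>I. u X * act h (w X)) * act h (c a))"
    by (simp only: sep cong: sum.cong)
  also have "\<dots> = (\<Sum>X\<in>I. u X * (\<Sum>h\<in>H. act h (w X * c a)))"
    unfolding sum_distrib_right sum_distrib_left poly_act_mult[OF V] mult.assoc by (rule sum.swap)
  also have "\<dots> = 0" using trace_0 by simp
  finally have "D * c a = 0" .
  then show "c a = 0" using D mpoly_no_zero_divisors by blast
qed

text \<open>An element of \<open>H\<close> transforms an expansion of \<open>t\<close> into another one, and expansions are unique.\<close>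

lemma rspan_descend:
  assumes H: "subgrp H" and E: "E \<subseteq> Cov H" and ind: "indep (mpolys B) E"
    and t: "t \<in> Cov H" "t \<in> rspan (mpolys B) E"
  shows "t \<in> rspan (Inv H) E"
proof -
  obtain A c where A: "finite A" "A \<subseteq> E" "c \<in> A \<rightarrow> mpolys B" "t = (\<Sum>a\<in>A. c a \<star> a)"
    using t(2) by (auto simp: rspan_def)
  have "act h (c a) = c a" if h: "h \<in> H" and a: "a \<in> A" for h a
  proof -
    have "(\<Sum>a\<in>A. act h (c a) \<star> a) = (\<Sum>a\<in>A. tact h (c a \<star> a))"
      using A(2) E h subgrp_in_G[OF H h] by (intro sum.cong refl) (auto simp: tact_smul Cov_tact)
    also have "\<dots> = tact h t" by (simp add: A(4) tact_sum subgrp_in_G[OF H h])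
    also have "\<dots> = (\<Sum>a\<in>A. c a \<star> a)" using Cov_tact[OF t(1) h] A(4) by simp
    finally show ?thesis
      using A(3) by (intro indep_eq[OF ind[folded Inv_trivial] A(1,2) _ _ _ a])
        (auto simp: Inv_trivial intro!: act_mpolys)
  qed
  then have "c \<in> A \<rightarrow> Inv H" using A(3) by (auto simp: Inv_def)
  then show ?thesis using A by (auto simp: rspan_def)
qed

subsection \<open>Subgroups that contain the elements fixing a hyperplane\<close>

text \<open>
  The separating functional of \<open>H\<close>, applied to the traces of \<open>w t\<close> from \<open>H\<close> to \<open>G\<close>, removes all cosets
  except \<open>H\<close> itself and leaves a multiple of \<open>t\<close>.
\<close>

lemma multiple_in_span:
  assumes H: "subgrp H" and y: "\<And>g. g \<in> G - H \<Longrightarrow> y g \<in> Inv H"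
    and t: "t \<in> Cov H" and gen: "Cov G \<subseteq> rspan (mpolys B) E"
  shows "(\<Prod>g\<in>G-H. act g (y g) - y g) \<star> t \<in> rspan (mpolys B) E"
proof -
  let ?D = "\<Prod>g\<in>G-H. act g (y g) - y g"
  have HG: "H \<subseteq> G" using subgrp_in_G[OF H] by blast
  obtain I :: "('v \<Rightarrow> 'v) set set" and u w where
    I: "finite I" "\<And>X. X \<in> I \<Longrightarrow> u X \<in> mpolys B" "\<And>X. X \<in> I \<Longrightarrow> w X \<in> Inv H"
    and sep: "\<And>h. h \<in> G \<Longrightarrow> (\<Sum>X\<in>I. u X * act h (w X)) = (if h \<in> H then ?D else 0)"
    by (rule separating_functional[where y = y, OF subgrp_G H y], assumption) (rule that)
  have "(\<Sum>X\<in>I. u X \<star> rel_trace G H (w X \<star> t)) =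
      (\<Sum>X\<in>I. \<Sum>C\<in>cosets G H. (u X * act (rep C) (w X)) \<star> tact (rep C) t)"
    unfolding rel_trace_def T.scale_sum_right
    by (intro sum.cong refl) (simp add: tact_smul rep_in[OF subgrp_G H HG])
  also have "\<dots> = (\<Sum>C\<in>cosets G H. (\<Sum>X\<in>I. u X * act (rep C) (w X)) \<star> tact (rep C) t)"
    by (subst sum.swap) (simp add: T.scale_sum_left)
  also have "\<dots> = (\<Sum>C\<in>cosets G H. if C = H then ?D \<star> tact (rep H) t else 0)"
    using rep_in[OF subgrp_G H HG] rep_in_subgroup_iff[OF subgrp_G H HG]
    by (intro sum.cong refl) (auto simp: sep)
  also have "\<dots> = ?D \<star> tact (rep H) t"
    using finite_cosets[OF subgrp_G H HG] subgroup_in_cosets[OF subgrp_G H HG] by simp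
  also have "\<dots> = ?D \<star> t"
    using rep_in_subgroup_iff[OF subgrp_G H HG subgroup_in_cosets[OF subgrp_G H HG]] Cov_tact[OF t] by simp
  finally have eq: "?D \<star> t = (\<Sum>X\<in>I. u X \<star> rel_trace G H (w X \<star> t))" by (rule sym)
  show ?thesis
    unfolding eq Inv_trivial[symmetric]
    using I gen rel_trace_Cov[OF subgrp_G H HG] smul_Cov[OF H _ t]
    by (intro rspan_sum rspan_smul) (auto simp: Inv_trivial)
qed

text \<open>
  If \<open>l z\<close> has the coefficients \<open>c\<^sub>a\<close> and \<open>D z\<close> has the coefficients \<open>d\<^sub>a\<close>, then \<open>D c\<^sub>a = l d\<^sub>a\<close> by independence.
  The prime \<open>l\<close> does not divide \<open>D\<close>, so it divides every \<open>c\<^sub>a\<close>.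
\<close>

lemma cancel_linear_form:
  assumes ind: "indep (mpolys B) E" and b0: "b0 \<in> B" "a b0 \<noteq> 0"
    and z: "linear_form B a \<star> z \<in> rspan (mpolys B) E" "D \<star> z \<in> rspan (mpolys B) E"
    and D: "D \<in> mpolys B" "\<not> (\<exists>q\<in>mpolys B. D = linear_form B a * q)"
  shows "z \<in> rspan (mpolys B) E"
proof -
  let ?l = "linear_form B a"
  obtain A c d where A: "finite A" "A \<subseteq> E" "c \<in> A \<rightarrow> mpolys B" "d \<in> A \<rightarrow> mpolys B"
    "?l \<star> z = (\<Sum>a\<in>A. c a \<star> a)" "D \<star> z = (\<Sum>a\<in>A. d a \<star> a)"
    by (rule rspan_common[OF z[folded Inv_trivial], unfolded Inv_trivial]) (rule that)
  obtain \<psi> :: "('v, 'k) mpoly \<Rightarrow> 'k npoly" where hom: "comm_ring_hom \<psi>"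
    and ker: "\<And>f. f \<in> mpolys B \<Longrightarrow> \<psi> f = 0 \<longleftrightarrow> (\<exists>q\<in>mpolys B. f = ?l * q)"
    by (rule linear_form_quotient_embedding[where a = a, OF V.finite_Basis b0]) (rule that)
  interpret \<psi>: comm_ring_hom \<psi> by (rule hom)
  have "\<exists>q\<in>mpolys B. c e = ?l * q" if e: "e \<in> A" for e
  proof -
    have "(\<Sum>a\<in>A. (D * c a) \<star> a) = (\<Sum>a\<in>A. (?l * d a) \<star> a)"
    proof -
      have "(\<Sum>a\<in>A. (D * c a) \<star> a) = D \<star> (?l \<star> z)" by (simp add: A(5) T.scale_sum_right)
      also have "\<dots> = ?l \<star> (D \<star> z)" by (simp add: mult.commute)
      also have "\<dots> = (\<Sum>a\<in>A. (?l * d a) \<star> a)" by (simp add: A(6) T.scale_sum_right)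
      finally show ?thesis .
    qed
    then have "D * c e = ?l * d e"
      using A(3,4) D(1) by (intro indep_eq[OF ind[folded Inv_trivial] A(1,2) _ _ _ e])
        (auto simp: Inv_trivial intro!: mult_mpolys linear_form_mpolys)
    moreover have B: "D * c e \<in> mpolys B" "d e \<in> mpolys B" "c e \<in> mpolys B" using A(3,4) D(1) e by (auto intro: mult_mpolys)
    ultimately have "\<psi> D * \<psi> (c e) = 0" using ker \<psi>.hom_mult by metis
    then show ?thesis using ker D B by auto
  qed
  then obtain q where q: "\<And>e. e \<in> A \<Longrightarrow> q e \<in> mpolys B" "\<And>e. e \<in> A \<Longrightarrow> c e = ?l * q e" by metis
  have "?l \<star> (z - (\<Sum>a\<in>A. q a \<star> a)) = 0"
    using A(5) q(2) by (simp add: T.scale_right_diff_distrib T.scale_sum_right)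
  then have "z - (\<Sum>a\<in>A. q a \<star> a) = 0"
    by (rule smul_eq_0) (rule linear_form_nonzero[where a = a, OF b0])
  then have "z = (\<Sum>a\<in>A. q a \<star> a)" by simp
  then show ?thesis using A(1,2) q(1) by (auto simp: rspan_def)
qed

text \<open>
  A product of linear forms multiplies \<open>t\<close> into the span.  They are cancelled one after the other,
  each with the help of a multiplier \<open>D\<close> that it does not divide.  Such a \<open>D\<close> exists because otherwise
  an element outside \<open>K\<close> would, up to a factor from \<open>K\<close>, fix the corresponding hyperplane.
\<close>

lemma Cov_subset_span:
  assumes K: "subgrp K" and refl: "\<And>g. g \<in> G \<Longrightarrow> fixes_hyperplane s g \<Longrightarrow> g \<in> K"
    and E: "E \<subseteq> Cov G" and ind: "indep (Inv G) E" and gen: "Cov G \<subseteq> rspan (Inv G) E"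
  shows "Cov K \<subseteq> rspan (mpolys B) E"
proof
  fix t assume t: "t \<in> Cov K"
  have ind': "indep (mpolys B) E" by (rule indep_extends[OF subgrp_G E ind])
  have gen': "Cov G \<subseteq> rspan (mpolys B) E"
    using gen rspan_mono[of "Inv G" "mpolys B" E] Inv_mpolys by blast
  \<comment> \<open>Every linear form is prime to some multiplier of \<open>t\<close> into the span.\<close>
  have coprime: "\<exists>D\<in>mpolys B. \<not> (\<exists>q\<in>mpolys B. D = linear_form B a * q) \<and> D \<star> t \<in> rspan (mpolys B) E"
    if b0: "b0 \<in> B" "a b0 \<noteq> 0" for a b0
  proof -
    obtain \<psi> :: "('v, 'k) mpoly \<Rightarrow> 'k npoly" where hom: "comm_ring_hom \<psi>"
      and ker: "\<And>f. f \<in> mpolys B \<Longrightarrow> \<psi> f = 0 \<longleftrightarrow> (\<exists>q\<in>mpolys B. f = linear_form B a * q)"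
      by (rule linear_form_quotient_embedding[where a = a, OF V.finite_Basis b0]) (rule that)
    interpret \<psi>: comm_ring_hom \<psi> by (rule hom)
    have "\<exists>y\<in>Inv K. \<psi> (act g y) \<noteq> \<psi> y" if g: "g \<in> G - K" for g
    proof (rule ccontr)
      assume "\<not> ?thesis"
      then obtain k where k: "k \<in> K" "\<And>x. x \<in> mpolys B \<Longrightarrow> \<psi> (act (g \<circ> k) x) = \<psi> x"
        using congruent_on_invariants[OF K _ hom, of g] g by blast
      have gk: "g \<circ> k \<in> G" using g k subgrp_comp[OF subgrp_G] subgrp_in_G[OF K] by blast
      have "fixes_hyperplane s (g \<circ> k)"
      proof (rule fixes_hyperplaneI[where a = a, OF gk b0])
        fix b assume b: "b \<in> B"
        have v: "var b \<in> mpolys B" using b by (simp add: single_mpolys)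
        then have "\<psi> (act (g \<circ> k) (var b)) = \<psi> (var b)" by (rule k(2))
        then have "\<psi> (act (g \<circ> k) (var b) - var b) = 0" by (simp only: \<psi>.hom_minus) simp
        moreover have "act (g \<circ> k) (var b) - var b \<in> mpolys B"
          unfolding displacement_linear_form[OF b] by (rule linear_form_mpolys)
        ultimately show "\<exists>q. act (g \<circ> k) (var b) - var b = linear_form B a * q" using ker by blast
      qed
      then have "g \<circ> k \<in> K" by (rule refl[OF gk])
      moreover obtain k' where "k' \<in> K" "k \<circ> k' = id" using subgrp_inverse[OF K k(1)] .
      ultimately have "g \<in> K" using subgrp_comp[OF K, of "g \<circ> k" k'] by (simp add: comp_assoc)
      then show False using g by blast
    qed
    then obtain y where y: "\<And>g. g \<in> G - K \<Longrightarrow> y g \<in> Inv K" "\<And>g. g \<in> G - K \<Longrightarrow> \<psi> (act g (y g)) \<noteq> \<psi> (y g)"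
      by metis
    let ?D = "\<Prod>g\<in>G-K. act g (y g) - y g"
    have "\<psi> ?D = (\<Prod>g\<in>G-K. \<psi> (act g (y g)) - \<psi> (y g))" by (simp add: \<psi>.hom_prod \<psi>.hom_minus)
    then have "\<psi> ?D \<noteq> 0" using y(2) finite_G by simp
    moreover have "?D \<in> mpolys B"
      using Inv_mpolys[OF y(1)] by (intro prod_mpolys diff_mpolys act_mpolys)
    ultimately have "\<not> (\<exists>q\<in>mpolys B. ?D = linear_form B a * q)" using ker by metis
    moreover have "?D \<star> t \<in> rspan (mpolys B) E" by (rule multiple_in_span[OF K y(1) t gen'])
    ultimately show ?thesis using \<open>?D \<in> mpolys B\<close> by (intro bexI[of _ ?D] conjI)
  qed
  obtain y where y: "\<And>g. g \<in> G - {id} \<Longrightarrow> y g \<in> mpolys B"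
    "\<And>g. g \<in> G - {id} \<Longrightarrow> \<exists>a. act g (y g) - y g = linear_form B a \<and> (\<exists>c\<in>B. a c \<noteq> 0)"
    using moving_coordinates by blast
  \<comment> \<open>The displacements of the chosen coordinates are linear forms; remove them from the product.\<close>
  have strip: "t \<in> rspan (mpolys B) E"
    if "finite L" "L \<subseteq> G - {id}" "(\<Prod>g\<in>L. act g (y g) - y g) \<star> t \<in> rspan (mpolys B) E" for L
    using that
  proof (induction L)
    case empty
    then show ?case by simp
  next
    case (insert g L)
    let ?P = "\<Prod>g\<in>L. act g (y g) - y g"
    obtain a b0 where a: "act g (y g) - y g = linear_form B a" "b0 \<in> B" "a b0 \<noteq> 0"
      using y(2) insert.prems(1) by blast
    obtain D where D: "D \<in> mpolys B" "\<not> (\<exists>q\<in>mpolys B. D = linear_form B a * q)" "D \<star> t \<in> rspan (mpolys B) E"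
      using coprime[of b0 a, OF a(2,3)] by blast
    have L: "h \<in> G - {id}" if "h \<in> L" for h using insert.prems(1) that by blast
    have P: "?P \<in> mpolys B"
      using y(1)[OF L] by (intro prod_mpolys diff_mpolys act_mpolys)
    have lP: "linear_form B a \<star> (?P \<star> t) \<in> rspan (mpolys B) E"
      using insert.prems(2) unfolding prod.insert[OF insert.hyps] a(1) T.scale_scale .
    have DP: "D \<star> (?P \<star> t) \<in> rspan (mpolys B) E"
      using rspan_smul[OF P[folded Inv_trivial] D(3)[folded Inv_trivial]]
      unfolding Inv_trivial T.scale_scale mult.commute[of ?P D] .
    have "?P \<star> t \<in> rspan (mpolys B) E"
      by (rule cancel_linear_form[where a = a, OF ind' a(2,3) lP DP D(1,2)])
    then show ?case using insert.IH insert.prems(1) by simp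
  qed
  have "(\<Prod>g\<in>G-{id}. act g (y g) - y g) \<star> t \<in> rspan (mpolys B) E"
    by (rule multiple_in_span[OF subgrp_trivial _ _ gen'])
      (use y(1) Cov_mpolys[OF t] in \<open>auto simp: Inv_trivial Cov_trivial\<close>)
  then show "t \<in> rspan (mpolys B) E" by (intro strip[of "G - {id}"]) (use finite_G in auto)
qed

end

section \<open>The grading\<close>

definition deg :: "('v \<Rightarrow>\<^sub>0 nat) \<Rightarrow> nat" where
  "deg \<alpha> = (\<Sum>b\<in>Poly_Mapping.keys \<alpha>. Poly_Mapping.lookup \<alpha> b)"

definition hcomp :: "nat \<Rightarrow> ('v, 'c::comm_monoid_add) mpoly \<Rightarrow> ('v, 'c) mpoly" where
  "hcomp d p = (\<Sum>\<alpha> | \<alpha> \<in> Poly_Mapping.keys p \<and> deg \<alpha> = d. Poly_Mapping.single \<alpha> (Poly_Mapping.lookup p \<alpha>))"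

lemma deg_add: "deg (\<alpha> + \<beta>) = deg \<alpha> + deg \<beta>"
proof -
  have "deg \<gamma> = (\<Sum>b\<in>Poly_Mapping.keys \<alpha> \<union> Poly_Mapping.keys \<beta>. Poly_Mapping.lookup \<gamma> b)"
    if "Poly_Mapping.keys \<gamma> \<subseteq> Poly_Mapping.keys \<alpha> \<union> Poly_Mapping.keys \<beta>" for \<gamma>
    unfolding deg_def using that by (intro sum.mono_neutral_left) (auto simp: in_keys_iff)
  then show ?thesis by (simp add: keys_monom_add lookup_add sum.distrib)
qed

lemma deg_0: "deg 0 = 0" and deg_single: "deg (Poly_Mapping.single b n) = n"
  by (simp_all add: deg_def)

lemma deg_eq_0_iff: "deg \<alpha> = 0 \<longleftrightarrow> \<alpha> = 0"
proof
  assume "deg \<alpha> = 0"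
  then have "Poly_Mapping.lookup \<alpha> b = 0" for b
    by (cases "b \<in> Poly_Mapping.keys \<alpha>") (auto simp: deg_def in_keys_iff)
  then show "\<alpha> = 0" by (intro poly_mapping_eqI) simp
qed (simp add: deg_0)

lemma lookup_hcomp: "Poly_Mapping.lookup (hcomp d p) \<alpha> = (if deg \<alpha> = d then Poly_Mapping.lookup p \<alpha> else 0)"
proof -
  have "Poly_Mapping.lookup (hcomp d p) \<alpha> =
      (\<Sum>\<beta> | \<beta> \<in> Poly_Mapping.keys p \<and> deg \<beta> = d. if \<beta> = \<alpha> then Poly_Mapping.lookup p \<alpha> else 0)"
    unfolding hcomp_def lookup_sum by (rule sum.cong) (auto simp: lookup_single when_def)
  also have "\<dots> = (if deg \<alpha> = d then Poly_Mapping.lookup p \<alpha> else 0)"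
    by (subst sum.delta) (auto simp: in_keys_iff)
  finally show ?thesis .
qed

lemma hcomp_add: "hcomp d (p + q) = hcomp d p + hcomp d q"
  by (rule poly_mapping_eqI) (simp add: lookup_hcomp lookup_add)

lemma hcomp_0 [simp]: "hcomp d 0 = 0"
  by (rule poly_mapping_eqI) (simp add: lookup_hcomp)

lemma hcomp_sum: "hcomp d (sum p I) = (\<Sum>i\<in>I. hcomp d (p i))"
  by (induction I rule: infinite_finite_induct) (simp_all add: hcomp_add)

lemma hcomp_single:
  "hcomp d (Poly_Mapping.single \<alpha> x) = (if deg \<alpha> = d then Poly_Mapping.single \<alpha> x else 0)"
  by (rule poly_mapping_eqI) (auto simp: lookup_hcomp lookup_single when_def)

lemma hcomp_hcomp: "hcomp d (hcomp e p) = (if d = e then hcomp e p else 0)"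
  by (rule poly_mapping_eqI) (simp add: lookup_hcomp)

lemma sum_hcomp: "(\<Sum>d\<in>deg ` Poly_Mapping.keys p. hcomp d p) = p"
  by (rule poly_mapping_eqI) (auto simp: lookup_sum lookup_hcomp in_keys_iff sum.delta')

lemma hcomp_mpolys: "p \<in> mpolys B \<Longrightarrow> hcomp d p \<in> mpolys B"
  by (auto simp: mpolys_def in_keys_iff lookup_hcomp split: if_splits)

lemma hcomp_zero_eq: "hcomp 0 p = Poly_Mapping.single 0 (Poly_Mapping.lookup p 0)"
  by (rule poly_mapping_eqI) (auto simp: lookup_hcomp deg_eq_0_iff lookup_single when_def)

lemma convolution_single:
  fixes i :: nat and f :: "nat \<Rightarrow> nat \<Rightarrow> 'c::comm_monoid_add"
  shows "(\<Sum>l\<le>d. if i = l \<and> j = d - l then x else 0) = (if i + j = d then x else (0::'c))"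
proof -
  have "(\<Sum>l\<le>d. if i = l \<and> j = d - l then x else 0) = (\<Sum>l\<le>d. if l = i then (if i + j = d then x else 0) else 0)"
    by (rule sum.cong) auto
  then show ?thesis by simp
qed

lemma hcomp_mult:
  fixes f h :: "('v, 'c::comm_ring_1) mpoly"
  shows "hcomp d (f * h) = (\<Sum>i\<le>d. hcomp i f * hcomp (d - i) h)"
proof (induction f rule: poly_mapping_add_induct)
  case (single \<alpha> a)
  show ?case
  proof (induction h rule: poly_mapping_add_induct)
    case (single \<beta> b)
    have "(\<Sum>i\<le>d. hcomp i (Poly_Mapping.single \<alpha> a) * hcomp (d - i) (Poly_Mapping.single \<beta> b)) =
      (\<Sum>i\<le>d. if deg \<alpha> = i \<and> deg \<beta> = d - i then Poly_Mapping.single (\<alpha> + \<beta>) (a * b) else 0)"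
      by (rule sum.cong) (auto simp: hcomp_single mult_single)
    then show ?case by (simp only: convolution_single mult_single hcomp_single deg_add)
  qed (simp add: distrib_left hcomp_add sum.distrib)
qed (simp add: distrib_right hcomp_add sum.distrib)

lemma hcomp_homogeneous: "(\<And>\<alpha>. \<alpha> \<in> Poly_Mapping.keys p \<Longrightarrow> deg \<alpha> = e) \<Longrightarrow> hcomp d p = (if d = e then p else 0)"
  by (rule poly_mapping_eqI) (auto simp: lookup_hcomp in_keys_iff)

definition homogeneous :: "nat \<Rightarrow> ('v, 'c::zero) mpoly \<Rightarrow> bool" where
  "homogeneous e p \<longleftrightarrow> (\<forall>\<alpha>\<in>Poly_Mapping.keys p. deg \<alpha> = e)"

lemma homogeneous_mult:
  fixes p q :: "('v, 'c::comm_ring_1) mpoly"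
  shows "homogeneous d p \<Longrightarrow> homogeneous e q \<Longrightarrow> homogeneous (d + e) (p * q)"
  using keys_mult[of p q] by (fastforce simp: homogeneous_def deg_add)

lemma homogeneous_const: "homogeneous 0 (const a)"
  by (auto simp: homogeneous_def deg_0)

lemma homogeneous_one: "homogeneous 0 (1 :: ('v, 'c::comm_ring_1) mpoly)"
  unfolding single_one[symmetric] by (rule homogeneous_const)

lemma homogeneous_power:
  fixes p :: "('v, 'c::comm_ring_1) mpoly"
  assumes "homogeneous d p" shows "homogeneous (n * d) (p ^ n)"
proof (induction n)
  case 0
  show ?case by (simp add: homogeneous_one)
next
  case (Suc n)
  then show ?case using homogeneous_mult[OF assms Suc] by simp
qed

lemma homogeneous_prod:
  fixes p :: "'i \<Rightarrow> ('v, 'c::comm_ring_1) mpoly"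
  assumes "\<And>i. i \<in> I \<Longrightarrow> homogeneous (e i) (p i)"
  shows "homogeneous (sum e I) (prod p I)"
  using assms
proof (induction I rule: infinite_finite_induct)
  case (insert i I)
  then show ?case by (simp add: homogeneous_mult)
qed (simp_all add: homogeneous_one)

lemma homogeneous_sum:
  "(\<And>i. i \<in> I \<Longrightarrow> homogeneous e (p i)) \<Longrightarrow> homogeneous e (sum p I)"
proof (induction I rule: infinite_finite_induct)
  case (insert i I)
  then show ?case using keys_add[of "p i" "sum p I"] by (auto simp: homogeneous_def)
qed (auto simp: homogeneous_def)

context covariant_data
begin

lemma hcomp_smul: "hcomp d (f \<star> t) = (\<Sum>i\<le>d. hcomp i f \<star> hcomp (d - i) t)"
proof (induction f rule: poly_mapping_add_induct)
  case (single \<alpha> a)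
  show ?case
  proof (induction t rule: poly_mapping_add_induct)
    case (single \<beta> m)
    have eq: "Poly_Mapping.single \<alpha> a \<star> Poly_Mapping.single \<beta> m = Poly_Mapping.single (\<alpha> + \<beta>) (sM a m)"
      by (simp add: poly_smult_single[OF M] mult_single tensor_single[OF M])
    have "(\<Sum>i\<le>d. hcomp i (Poly_Mapping.single \<alpha> a) \<star> hcomp (d - i) (Poly_Mapping.single \<beta> m)) =
      (\<Sum>i\<le>d. if deg \<alpha> = i \<and> deg \<beta> = d - i then Poly_Mapping.single (\<alpha> + \<beta>) (sM a m) else 0)"
      by (rule sum.cong) (auto simp: hcomp_single eq)
    then show ?case by (simp only: convolution_single eq hcomp_single deg_add)
  qed (simp add: T.scale_right_distrib hcomp_add sum.distrib)
qed (simp add: T.scale_left_distrib hcomp_add sum.distrib)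

lemma homogeneous_act_single: "homogeneous (deg \<alpha>) (act g (Poly_Mapping.single \<alpha> a))"
proof -
  have "homogeneous 1 (coord_act s B g b)" for b
    unfolding coord_act_def by (rule homogeneous_sum) (auto simp: homogeneous_def deg_single)
  then have "homogeneous (0 + (\<Sum>b\<in>Poly_Mapping.keys \<alpha>. Poly_Mapping.lookup \<alpha> b * 1))
      (const a * (\<Prod>b\<in>Poly_Mapping.keys \<alpha>. coord_act s B g b ^ Poly_Mapping.lookup \<alpha> b))"
    by (intro homogeneous_mult homogeneous_const homogeneous_prod homogeneous_power)
  then show ?thesis by (simp add: poly_act_single[OF V] deg_def)
qed

lemma hcomp_act: "act g (hcomp d f) = hcomp d (act g f)"
proof (induction f rule: poly_mapping_add_induct)
  case (single \<alpha> a)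
  have "hcomp d (act g (Poly_Mapping.single \<alpha> a)) = (if d = deg \<alpha> then act g (Poly_Mapping.single \<alpha> a) else 0)"
    using homogeneous_act_single by (intro hcomp_homogeneous) (auto simp: homogeneous_def)
  then show ?case by (auto simp: hcomp_single poly_act_0[OF V])
qed (simp add: hcomp_add poly_act_add[OF V])

lemma hcomp_tact: "g \<in> G \<Longrightarrow> tact g (hcomp d t) = hcomp d (tact g t)"
proof (induction t rule: poly_mapping_add_induct)
  case (single \<alpha> m)
  have "hcomp d (tensor sM (act g (Poly_Mapping.single \<alpha> 1)) (\<rho> g m)) =
      (if d = deg \<alpha> then tensor sM (act g (Poly_Mapping.single \<alpha> 1)) (\<rho> g m) else 0)"
    using homogeneous_act_single[of \<alpha> g 1]
    by (intro hcomp_homogeneous) (auto simp: homogeneous_def in_keys_iff lookup_tensor[OF M])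
  then show ?case using single
    by (auto simp: hcomp_single tact_0 tensor_act_single[OF V M \<rho>])
qed (simp add: hcomp_add tact_add)

lemma hcomp_Inv: "f \<in> Inv H \<Longrightarrow> hcomp d f \<in> Inv H"
  by (auto simp: Inv_def hcomp_mpolys hcomp_act)

lemma hcomp_Cov: "subgrp H \<Longrightarrow> t \<in> Cov H \<Longrightarrow> hcomp d t \<in> Cov H"
  by (auto simp: Cov_def hcomp_mpolys hcomp_tact subgrp_in_G)

lemma vector_space_covariants: "vector_space (\<lambda>a t. const a \<star> t)"
  by unfold_locales
    (simp_all add: T.scale_right_distrib single_add T.scale_left_distrib mult_single)

text \<open>
  Let \<open>N\<close> be the submodule of \<open>Cov K\<close> generated by the multiples with invariants that have no constant
  term.  Choose \<open>E'\<close> in \<open>E\<close> such that it maps to a vector space basis of \<open>Cov K\<close> modulo \<open>N\<close>.  Then \<open>E'\<close>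
  generates, by induction on the degree.  It is independent: the coordinates of \<open>Cov K\<close> modulo
  \<open>N\<close> with respect to \<open>E'\<close> lift, by means of the basis \<open>F\<close>, to linear functionals with values in the
  invariant ring.  On \<open>E'\<close> these form a matrix that is the identity up to entries without
  constant term.  It annihilates the coefficients of any relation, so that the component of least
  degree of these coefficients vanishes.
\<close>

lemma homogeneous_generators_contain_basis:
  assumes K: "subgrp K" and F: "F \<subseteq> Cov K" "indep (Inv K) F" "Cov K \<subseteq> rspan (Inv K) F"
    and E: "E \<subseteq> Cov K" "Cov K \<subseteq> rspan (Inv K) E" and hom: "\<And>e. e \<in> E \<Longrightarrow> \<exists>d. hcomp d e = e"
  obtains E' where "E' \<subseteq> E" "indep (Inv K) E'" "Cov K \<subseteq> rspan (Inv K) E'"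
proof -
  interpret Tk: vector_space "\<lambda>a t. const a \<star> t" by (rule vector_space_covariants)
  define gens where "gens = {r \<star> y | r y. r \<in> Inv K \<and> Poly_Mapping.lookup r 0 = 0 \<and> y \<in> Cov K}"
  define N where "N = Tk.span gens"
  obtain BN where BN: "BN \<subseteq> N" "Tk.independent BN" "N \<subseteq> Tk.span BN"
    by (rule Tk.maximal_independent_subset[of N])
  obtain B' where B': "BN \<subseteq> B'" "B' \<subseteq> BN \<union> E" "Tk.independent B'" "BN \<union> E \<subseteq> Tk.span B'"
    by (rule Tk.maximal_independent_subset_extend[of BN "BN \<union> E", OF _ BN(2)]) auto
  \<comment> \<open>\<open>B'\<close> extends a basis of \<open>N\<close> by elements of \<open>E\<close> to a vector space basis of \<open>Cov K\<close>.\<close>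
  define E' where "E' = B' - BN"
  have E'E: "E' \<subseteq> E" using B'(2) by (auto simp: E'_def)
  have E'Cov: "E' \<subseteq> Cov K" using E'E E(1) by blast
  have mod_N: "r \<star> y - const (Poly_Mapping.lookup r 0) \<star> y \<in> N" if "r \<in> Inv K" "y \<in> Cov K" for r y
  proof -
    have "(r - const (Poly_Mapping.lookup r 0)) \<star> y \<in> gens"
      unfolding gens_def using that diff_Inv[OF _ const_Inv]
      by (intro CollectI exI[of _ "r - const (Poly_Mapping.lookup r 0)"] exI[of _ y]) (auto simp: lookup_minus)
    then show ?thesis unfolding N_def T.scale_left_diff_distrib by (rule Tk.span_base)
  qed
  have N_B': "N \<subseteq> Tk.span B'"
    using BN(3) Tk.span_mono[OF B'(1)] by blast
  have Cov_B': "x \<in> Tk.span B'" if "x \<in> Cov K" for x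
  proof -
    have "x \<in> rspan (Inv K) E" using that E(2) by blast
    then obtain A c where A: "A \<subseteq> E" "c \<in> A \<rightarrow> Inv K" "x = (\<Sum>a\<in>A. c a \<star> a)"
      by (auto simp: rspan_def)
    have "c a \<star> a \<in> Tk.span B'" if a: "a \<in> A" for a
    proof -
      have "c a \<star> a - const (Poly_Mapping.lookup (c a) 0) \<star> a \<in> Tk.span B'"
        using mod_N[of "c a" a] A a E(1) N_B' by blast
      moreover have "const (Poly_Mapping.lookup (c a) 0) \<star> a \<in> Tk.span B'"
        using A a B'(4) by (intro Tk.span_scale) auto
      ultimately show ?thesis using Tk.span_add by fastforce
    qed
    then show ?thesis unfolding A(3) by (rule Tk.span_sum)
  qed
  let ?Q = "rspan (Inv K) E'"
  have comp_gen: "hcomp d x \<in> ?Q" if "x \<in> Cov K" for d x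
    using that
  proof (induction d arbitrary: x rule: less_induct)
    case (less d)
    let ?P = "{x. hcomp d x \<in> ?Q}"
    have sub: "Tk.subspace ?P"
    proof (rule Tk.subspaceI)
      show "const a \<star> x \<in> ?P" if "x \<in> ?P" for a x
      proof -
        have "hcomp d (const a \<star> x) = (\<Sum>i\<le>d. if i = 0 then const a \<star> hcomp d x else 0)"
          unfolding hcomp_smul by (rule sum.cong) (auto simp: hcomp_single deg_0)
        also have "\<dots> = const a \<star> hcomp d x" by simp
        finally show ?thesis using that rspan_smul[OF const_Inv] by auto
      qed
    qed (auto simp: hcomp_add rspan_zero rspan_add)
    have "gens \<subseteq> ?P"
    proof
      fix z assume "z \<in> gens"
      then obtain r y where z: "z = r \<star> y" "r \<in> Inv K" "Poly_Mapping.lookup r 0 = 0" "y \<in> Cov K"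
        by (auto simp: gens_def)
      have "hcomp i r \<star> hcomp (d - i) y \<in> ?Q" if "i \<in> {..d}" for i
      proof (cases "i = 0")
        case True
        then show ?thesis using z(3) by (simp add: hcomp_zero_eq rspan_zero)
      next
        case False
        then show ?thesis using that z by (intro rspan_smul hcomp_Inv less.IH) auto
      qed
      then show "z \<in> ?P" unfolding z(1) mem_Collect_eq hcomp_smul by (rule rspan_sum)
    qed
    then have NP: "N \<subseteq> ?P" unfolding N_def using sub by (rule Tk.span_minimal)
    have "E' \<subseteq> ?P"
    proof
      fix e assume e: "e \<in> E'"
      then obtain n where n: "hcomp n e = e" using hom E'E by blast
      have "hcomp d (hcomp n e) \<in> ?Q" unfolding hcomp_hcomp unfolding n using rspan_base[OF e] rspan_zero by simp
      then show "e \<in> ?P" using n by simp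
    qed
    then have "B' \<subseteq> ?P" using NP BN(1) by (auto simp: E'_def)
    then have "Tk.span B' \<subseteq> ?P" using sub by (rule Tk.span_minimal)
    then show ?case using Cov_B' less.prems by blast
  qed
  have gen: "Cov K \<subseteq> ?Q"
  proof
    fix x assume "x \<in> Cov K"
    then have "(\<Sum>d\<in>deg ` Poly_Mapping.keys x. hcomp d x) \<in> ?Q" by (intro rspan_sum comp_gen)
    then show "x \<in> ?Q" by (simp only: sum_hcomp)
  qed
  have "indep (Inv K) E'"
    unfolding indep_def
  proof (intro allI impI, elim conjE)
    fix A c assume A: "finite A" "A \<subseteq> E'" "c \<in> A \<rightarrow> Inv K" "(\<Sum>a\<in>A. c a \<star> a) = 0"
    define expansion where "expansion a J m \<longleftrightarrow>
        finite J \<and> J \<subseteq> F \<and> m \<in> J \<rightarrow> Inv K \<and> a = (\<Sum>j\<in>J. m j \<star> j)" for a J m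
    have "\<exists>J m. expansion a J m" if "a \<in> A" for a
    proof -
      have "a \<in> rspan (Inv K) F" using that A(2) E'Cov F(3) by blast
      then show ?thesis by (simp add: rspan_def expansion_def)
    qed
    then obtain J0 m0 where J0: "\<And>a. a \<in> A \<Longrightarrow> expansion a (J0 a) (m0 a)" by metis
    define J where "J = (\<Union>a\<in>A. J0 a)"
    have J: "finite J" "J \<subseteq> F" using J0 A(1) by (auto simp: J_def expansion_def)
    have "\<exists>m. expansion a J m" if a: "a \<in> A" for a
    proof -
      have sub: "J0 a \<subseteq> J" using a by (auto simp: J_def)
      from J0[OF a] have J0a: "finite (J0 a)" "m0 a \<in> J0 a \<rightarrow> Inv K" "a = (\<Sum>j\<in>J0 a. m0 a j \<star> j)"
        unfolding expansion_def by - (elim conjE, assumption)+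
      obtain m' where "m' \<in> J \<rightarrow> Inv K" "a = (\<Sum>j\<in>J. m' j \<star> j)"
        by (rule rspan_superset[OF J0a(1) sub J(1) J0a(2,3)])
      with J have "expansion a J m'" unfolding expansion_def by (intro conjI)
      then show "\<exists>m. expansion a J m" by (intro exI[of "expansion a J" m'])
    qed
    then obtain m where "\<And>a. a \<in> A \<Longrightarrow> expansion a J (m a)" by metis
    then have m: "\<And>a. a \<in> A \<Longrightarrow> m a \<in> J \<rightarrow> Inv K" "\<And>a. a \<in> A \<Longrightarrow> a = (\<Sum>j\<in>J. m a j \<star> j)"
      unfolding expansion_def by blast+
    have mult_0: "(\<Sum>a\<in>A. c a * m a j) = 0" if j: "j \<in> J" for j
    proof (rule indepD[OF F(2) J(1,2) _ _ j])
      show "(\<lambda>j. \<Sum>a\<in>A. c a * m a j) \<in> J \<rightarrow> Inv K"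
        using A(3) m(1) by (auto simp: Pi_iff intro!: sum_Inv mult_Inv)
      have "(\<Sum>j\<in>J. (\<Sum>a\<in>A. c a * m a j) \<star> j) = (\<Sum>a\<in>A. c a \<star> (\<Sum>j\<in>J. m a j \<star> j))"
        unfolding T.scale_sum_left T.scale_sum_right T.scale_scale by (rule sum.swap)
      also have "\<dots> = (\<Sum>a\<in>A. c a \<star> a)" by (rule sum.cong) (simp_all flip: m(2))
      finally show "(\<Sum>j\<in>J. (\<Sum>a\<in>A. c a * m a j) \<star> j) = 0" using A(4) by simp
    qed
    \<comment> \<open>The coordinate modulo \<open>N\<close> that belongs to \<open>e\<close>.\<close>
    define lam where "lam e x = Tk.representation B' x e" for e x
    have lam_N: "lam e x = 0" if "e \<in> A" "x \<in> N" for e x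
    proof -
      have "Tk.representation B' x = Tk.representation BN x"
        by (rule Tk.representation_extend) (use B' BN that in auto)
      moreover have "Tk.representation BN x e = 0"
        using Tk.representation_ne_zero[of BN x e] that(1) A(2) by (auto simp: E'_def)
      ultimately show ?thesis by (simp add: lam_def)
    qed
    \<comment> \<open>Its lift, which is linear over the invariants, evaluated at \<open>a\<close>.\<close>
    define L where "L a e = (\<Sum>j\<in>J. m a j * const (lam e j))" for a e
    have L_const: "Poly_Mapping.lookup (L a e) 0 = (if a = e then 1 else 0)" if a: "a \<in> A" and e: "e \<in> A" for a e
    proof -
      have look: "Poly_Mapping.lookup (p * const x) 0 = Poly_Mapping.lookup p 0 * x" for p :: "('v, 'k) mpoly" and x
      proof -
        have "Poly_Mapping.lookup (const x * p) 0 = x * Poly_Mapping.lookup p 0"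
          by (simp add: Poly_Mapping.map.rep_eq when_def flip: mult_map_scale_conv_mult)
        then show ?thesis by (simp only: mult.commute)
      qed
      have jC: "j \<in> Cov K" if "j \<in> J" for j using that J(2) F(1) by blast
      let ?a0 = "\<Sum>j\<in>J. const (Poly_Mapping.lookup (m a j) 0) \<star> j"
      have "a - ?a0 = (\<Sum>j\<in>J. m a j \<star> j - const (Poly_Mapping.lookup (m a j) 0) \<star> j)"
        by (subst m(2)[OF a]) (simp only: sum_subtractf)
      also have "\<dots> \<in> N"
        unfolding N_def by (intro Tk.span_sum mod_N[unfolded N_def] jC) (use m(1)[OF a] in auto)
      finally have "lam e (a - ?a0) = 0" by (rule lam_N[OF e])
      moreover have a0: "?a0 \<in> Tk.span B'" by (intro Tk.span_sum Tk.span_scale Cov_B' jC)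
      moreover have "a \<in> Tk.span B'" using Cov_B' a A(2) E'Cov by blast
      ultimately have "lam e a = lam e ?a0"
        unfolding lam_def by (simp add: Tk.representation_diff[OF B'(3)])
      also have "\<dots> = (\<Sum>j\<in>J. Poly_Mapping.lookup (m a j) 0 * lam e j)"
        unfolding lam_def using Cov_B' jC
        by (simp add: Tk.representation_sum[OF B'(3)] Tk.representation_scale[OF B'(3)] Tk.span_scale)
      also have "\<dots> = Poly_Mapping.lookup (L a e) 0"
        by (simp add: L_def lookup_sum look)
      finally have "Poly_Mapping.lookup (L a e) 0 = lam e a" by (rule sym)
      also have "\<dots> = (if a = e then 1 else 0)"
        unfolding lam_def using a A(2) by (subst Tk.representation_basis[OF B'(3)]) (auto simp: E'_def)
      finally show ?thesis .
    qed
    have cL: "(\<Sum>a\<in>A. c a * L a e) = 0" for e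
    proof -
      have "(\<Sum>a\<in>A. c a * L a e) = (\<Sum>j\<in>J. (\<Sum>a\<in>A. c a * m a j) * const (lam e j))"
        unfolding L_def sum_distrib_left sum_distrib_right mult.assoc by (rule sum.swap)
      then show ?thesis by (simp add: mult_0)
    qed
    have comp_0: "hcomp d (c e) = 0" if "e \<in> A" for d e
      using that
    proof (induction d arbitrary: e rule: less_induct)
      case (less d)
      have "(\<Sum>i\<le>d. hcomp i (c a) * hcomp (d - i) (L a e)) = (if a = e then hcomp d (c a) else 0)"
        if a: "a \<in> A" for a
      proof -
        have "(\<Sum>i\<le>d. hcomp i (c a) * hcomp (d - i) (L a e)) =
            (\<Sum>i\<le>d. if i = d then hcomp d (c a) * hcomp 0 (L a e) else 0)"
          using less.IH[OF _ a] by (intro sum.cong) auto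
        then show ?thesis
          by (simp add: hcomp_zero_eq L_const[OF a less.prems])
      qed
      then have "hcomp d (\<Sum>a\<in>A. c a * L a e) = (\<Sum>a\<in>A. if a = e then hcomp d (c a) else 0)"
        unfolding hcomp_sum hcomp_mult by (rule sum.cong[OF HOL.refl])
      then show ?case using A(1) less.prems by (simp add: cL)
    qed
    show "\<forall>a\<in>A. c a = 0"
    proof
      fix a assume "a \<in> A"
      then have "(\<Sum>d\<in>deg ` Poly_Mapping.keys (c a). hcomp d (c a)) = 0" by (simp add: comp_0)
      then show "c a = 0" by (simp only: sum_hcomp)
    qed
  qed
  then show ?thesis using that E'E gen by blast
qed

section \<open>Bases of modules of covariants\<close>

lemma carrier_covariants: "carrier (covariants s B sM \<rho> H) = Cov H"
  and carrier_invariant_ring: "carrier (invariant_ring s B H) = Inv H"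
  by (simp_all add: covariants_def invariant_ring_def Cov_def Inv_def)

lemma finsum_covariants:
  assumes H: "subgrp H" and "finite A" "f \<in> A \<rightarrow> Cov H"
  shows "finsum (covariants s B sM \<rho> H) f A = sum f A"
proof -
  have "H \<subseteq> G" using subgrp_in_G[OF H] by blast
  then interpret C: Module.module "invariant_ring s B H" "covariants s B sM \<rho> H"
    by (rule module_covariants[OF V M \<rho>])
  show ?thesis using assms(2,3)
  proof (induction A)
    case empty
    show ?case unfolding C.M.finsum_empty by (simp add: covariants_def)
  next
    case (insert a A)
    then show ?case
      by (subst C.M.finsum_insert) (auto simp: carrier_covariants, simp add: covariants_def)
  qed
qed

lemma combination_eq_sum:
  assumes H: "subgrp H" and "E \<subseteq> Cov H" "finite A" "A \<subseteq> E" "c \<in> A \<rightarrow> Inv H"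
  shows "(\<Oplus>\<^bsub>covariants s B sM \<rho> H\<^esub>a\<in>A. c a \<odot>\<^bsub>covariants s B sM \<rho> H\<^esub> a) = (\<Sum>a\<in>A. c a \<star> a)"
proof -
  have "(\<lambda>a. c a \<star> a) \<in> A \<rightarrow> Cov H" using assms by (auto intro!: smul_Cov[OF H])
  moreover have "c a \<odot>\<^bsub>covariants s B sM \<rho> H\<^esub> a = c a \<star> a" for a by (simp add: covariants_def)
  ultimately show ?thesis using finsum_covariants[OF H assms(3)] by simp
qed

lemma generates_iff:
  assumes H: "subgrp H"
  shows "generates_module (invariant_ring s B H) (covariants s B sM \<rho> H) E \<longleftrightarrow>
    E \<subseteq> Cov H \<and> Cov H \<subseteq> rspan (Inv H) E"
proof -
  have eq: "(\<exists>A c. finite A \<and> A \<subseteq> E \<and> c \<in> A \<rightarrow> Inv H \<and>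
      x = (\<Oplus>\<^bsub>covariants s B sM \<rho> H\<^esub>a\<in>A. c a \<odot>\<^bsub>covariants s B sM \<rho> H\<^esub> a)) \<longleftrightarrow> x \<in> rspan (Inv H) E"
    if "E \<subseteq> Cov H" for x
    unfolding rspan_def mem_Collect_eq by (simp add: combination_eq_sum[OF H that] cong: conj_cong)
  show ?thesis
  proof (cases "E \<subseteq> Cov H")
    case True
    then show ?thesis
      unfolding generates_module_def carrier_covariants carrier_invariant_ring
        subset_eq[of "Cov H" "rspan (Inv H) E"] by (simp only: eq[OF True])
  qed (simp add: generates_module_def carrier_covariants)
qed

lemma module_independent_iff:
  assumes H: "subgrp H" and E: "E \<subseteq> Cov H"
  shows "module_independent (invariant_ring s B H) (covariants s B sM \<rho> H) E \<longleftrightarrow> indep (Inv H) E"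
proof -
  have z: "\<zero>\<^bsub>covariants s B sM \<rho> H\<^esub> = 0" "\<zero>\<^bsub>invariant_ring s B H\<^esub> = 0"
    by (simp_all add: covariants_def invariant_ring_def)
  show ?thesis
    unfolding module_independent_def indep_def carrier_invariant_ring z
    by (simp add: combination_eq_sum[OF H E] cong: conj_cong)
qed

lemma free_iff:
  assumes H: "subgrp H"
  shows "free_module (invariant_ring s B H) (covariants s B sM \<rho> H) \<longleftrightarrow>
    (\<exists>E. E \<subseteq> Cov H \<and> Cov H \<subseteq> rspan (Inv H) E \<and> indep (Inv H) E)"
  unfolding free_module_def generates_iff[OF H] using module_independent_iff[OF H] by blast

lemma share_generators_iff:
  assumes K: "subgrp K"
  shows "share_generators s B sM \<rho> G K \<longleftrightarrow>
    (\<exists>E. E \<subseteq> Cov G \<and> Cov K \<subseteq> rspan (Inv K) E)"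
proof -
  have "K \<subseteq> G" using subgrp_in_G[OF K] by blast
  then have "Cov G \<subseteq> Cov K" by (rule Cov_mono)
  then show ?thesis
    unfolding share_generators_def generates_iff[OF K] carrier_covariants by blast
qed

theorem free_covariants_iff:
  assumes K: "subgrp K" and refl: "\<And>g. g \<in> G \<Longrightarrow> fixes_hyperplane s g \<Longrightarrow> g \<in> K"
  shows "free_module (invariant_ring s B G) (covariants s B sM \<rho> G) \<longleftrightarrow>
    free_module (invariant_ring s B K) (covariants s B sM \<rho> K) \<and> share_generators s B sM \<rho> G K"
    (is "?free_G \<longleftrightarrow> ?free_K \<and> ?share")
proof
  have KG: "K \<subseteq> G" using subgrp_in_G[OF K] by blast
  have InvP: "Inv H \<subseteq> mpolys B" for H using Inv_mpolys by blast
  {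
    assume ?free_G
    then obtain E where E: "E \<subseteq> Cov G" "Cov G \<subseteq> rspan (Inv G) E" "indep (Inv G) E"
      unfolding free_iff[OF subgrp_G] by blast
    have EK: "E \<subseteq> Cov K" using E(1) Cov_mono[OF KG] by blast
    have ind: "indep (mpolys B) E" by (rule indep_extends[OF subgrp_G E(1,3)])
    have gen: "Cov K \<subseteq> rspan (Inv K) E"
    proof
      fix t assume t: "t \<in> Cov K"
      then have "t \<in> rspan (mpolys B) E" using Cov_subset_span[OF K refl E(1,3,2)] by blast
      then show "t \<in> rspan (Inv K) E" by (rule rspan_descend[OF K EK ind t])
    qed
    moreover have "indep (Inv K) E" by (rule indep_mono[OF InvP ind])
    ultimately show "?free_K \<and> ?share"
      unfolding free_iff[OF K] share_generators_iff[OF K] using EK E(1) by blast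
  next
    assume "?free_K \<and> ?share"
    then obtain F E where F: "F \<subseteq> Cov K" "Cov K \<subseteq> rspan (Inv K) F" "indep (Inv K) F"
      and E: "E \<subseteq> Cov G" "Cov K \<subseteq> rspan (Inv K) E"
      unfolding free_iff[OF K] share_generators_iff[OF K] by blast
    \<comment> \<open>The homogeneous components of the shared generators are shared generators as well.\<close>
    define Eh where "Eh = (\<Union>d. hcomp d ` E)"
    have EhG: "Eh \<subseteq> Cov G" using E(1) hcomp_Cov[OF subgrp_G] by (auto simp: Eh_def)
    have EhK: "Eh \<subseteq> Cov K" using EhG Cov_mono[OF KG] by blast
    have "E \<subseteq> rspan (Inv K) Eh"
    proof
      fix e assume "e \<in> E"
      then have "(\<Sum>d\<in>deg ` Poly_Mapping.keys e. hcomp d e) \<in> rspan (Inv K) Eh"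
        by (intro rspan_sum rspan_base) (auto simp: Eh_def)
      then show "e \<in> rspan (Inv K) Eh" by (simp only: sum_hcomp)
    qed
    then have gen_Eh: "Cov K \<subseteq> rspan (Inv K) Eh" using rspan_idem E(2) by blast
    have hom: "\<exists>d. hcomp d e = e" if "e \<in> Eh" for e
      using that by (auto simp: Eh_def hcomp_hcomp)
    obtain E' where E': "E' \<subseteq> Eh" "indep (Inv K) E'" "Cov K \<subseteq> rspan (Inv K) E'"
      by (rule homogeneous_generators_contain_basis[OF K F(1,3,2) EhK gen_Eh hom])
    have E'G: "E' \<subseteq> Cov G" and E'K: "E' \<subseteq> Cov K" using E'(1) EhG EhK by blast+
    have ind: "indep (mpolys B) E'" by (rule indep_extends[OF K E'K E'(2)])
    have "Cov G \<subseteq> rspan (Inv G) E'"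
    proof
      fix t assume t: "t \<in> Cov G"
      then have "t \<in> rspan (Inv K) E'" using Cov_mono[OF KG] E'(3) by blast
      then have "t \<in> rspan (mpolys B) E'" using rspan_mono[OF InvP] by blast
      then show "t \<in> rspan (Inv G) E'" by (rule rspan_descend[OF subgrp_G E'G ind t])
    qed
    moreover have "indep (Inv G) E'" by (rule indep_mono[OF InvP ind])
    ultimately show ?free_G unfolding free_iff[OF subgrp_G] using E'G by blast
  }
qed

end

theorem corollary1:
  fixes scaleV :: "'k::field \<Rightarrow> 'v::ab_group_add \<Rightarrow> 'v" and BV :: "'v set"
    and scaleM :: "'k \<Rightarrow> 'm::ab_group_add \<Rightarrow> 'm" and BM :: "'m set"
    and G K W :: "('v \<Rightarrow> 'v) set"
    and \<rho> :: "('v \<Rightarrow> 'v) \<Rightarrow> 'm \<Rightarrow> 'm"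
  assumes V: "finite_dimensional_vector_space scaleV BV"
    and M: "finite_dimensional_vector_space scaleM BM"
    and G: "subgroup G (general_linear scaleV)" "finite G"
    and \<rho>: "\<rho> \<in> hom (general_linear scaleV\<lparr>carrier := G\<rparr>) (general_linear scaleM)"
    and W: "W = generate (general_linear scaleV) {g \<in> G. fixes_hyperplane scaleV g}"
    and K: "subgroup K (general_linear scaleV)" "W \<subseteq> K" "K \<subseteq> G"
  shows "free_module (invariant_ring scaleV BV G) (covariants scaleV BV scaleM \<rho> G) \<longleftrightarrow>
           free_module (invariant_ring scaleV BV K) (covariants scaleV BV scaleM \<rho> K) \<and>
           share_generators scaleV BV scaleM \<rho> G K"
proof -
  have "vector_space scaleM"
    using M by (simp add: finite_dimensional_vector_space_def)
  then interpret covariant_data scaleV BV G scaleM \<rho>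
    using V G \<rho> by (intro covariant_data.intro linear_group.intro covariant_data_axioms.intro)
  show ?thesis
  proof (rule free_covariants_iff)
    show "subgrp K" using K by (simp add: subgrp_def)
    show "g \<in> K" if "g \<in> G" "fixes_hyperplane scaleV g" for g
      using that K(2) unfolding W by (auto intro: generate.incl)
  qed
qed

end
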